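(* Let $\Omega\subset\mathbb{R}^N$ be a bounded uniformly convex domain, i.e. there exist $R>0$ and $Y\subset\mathbb{R}^N$ with $\Omega=\bigcap_{y\in Y}B_R(y)$. Let $F\in C(\Omega\times\mathbb{S}^N;\mathbb{R})$ and $H\in C(\mathbb{R}^N;\mathbb{R})$. Assume: (1) there is $\beta>0$ such that $F(x,X+Z)-F(x,X)\le \beta\lambda_N(Z)$ for all $(x,X)\in\Omega\times\mathbb{S}^N$ and all $Z\in\mathbb{S}^N$ with $Z\le 0$; (2) $F(x,\sigma X)=\sigma F(x,X)$ for all $\sigma>0$ and $(x,X)\in\Omega\times\mathbb{S}^N$; (3) there are $b,c>0$ and $p\in(0,1)$ such that $\varepsilon H(\xi)\le H(\varepsilon\xi)$ for all $(\varepsilon,\xi)\in(0,1)\times\mathbb{R}^N$ and $0\le H(\xi)\le b|\xi|^p+c$ for all $\xi\in\mathbb{R}^N$; (4) $f\in C(\Omega)\cap L^\infty(\Omega)$ and $\sup_\Omega f<0$; (5) (comparison with strict supersolutions) if $u\in USC(\overline\Omega)$ and $v\in LSC(\overline\Omega)$ are respectively a subsolution and a strict supersolution of the Dirichlet problem $$F(x,D^2u)+H(Du)=f(x)\ \text{ in }\Omega,\qquad u=0\ \text{ on }\partial\Omega,\qquad ( * )$$ then $u\le v$ in $\overline\Omega$. Then there exists a unique viscosity solution $u\in C(\overline\Omega)$ of $( * )$.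
   Context: $\mathbb{S}^N$ is the space of real symmetric $N\times N$ matrices with its usual order, and $\lambda_1(X)\le\dots\le\lambda_N(X)$ are the eigenvalues of $X\in\mathbb{S}^N$. $B_R(y)$ is the open ball of radius $R$ and center $y$. $USC(\overline\Omega)$ and $LSC(\overline\Omega)$ are the (real-valued) upper, resp. lower, semicontinuous functions on $\overline\Omega$. Viscosity notions for $( * )$: $u\in USC(\overline\Omega)$ is a subsolution if $u\le0$ on $\partial\Omega$ and $F(x_0,D^2\psi(x_0))+H(D\psi(x_0))\ge f(x_0)$ whenever $x_0\in\Omega$, $\psi\in C^2(\Omega)$ and $u-\psi$ has a local maximum at $x_0$. $v\in LSC(\overline\Omega)$ is a supersolution if $v\ge0$ on $\partial\Omega$ and $F(x_0,D^2\psi(x_0))+H(D\psi(x_0))\le f(x_0)$ whenever $x_0\in\Omega$, $\psi\in C^2(\Omega)$ and $v-\psi$ has a local minimum at $x_0$. A supersolution is strict if the last inequality holds with $f(x_0)$ replaced by $f(x_0)-\varepsilon$ for some constant $\varepsilon>0$ independent of $x_0$ and $\psi$. A solution is a function in $C(\overline\Omega)$ that is both a subsolution and a supersolution. *)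

theory Defs
  imports "HOL-Analysis.Analysis"
begin

definition sym_matrices :: "(real^'n^'n) set" where
  "sym_matrices = {X. transpose X = X}"

definition loewner_le :: "real^'n^'n \<Rightarrow> real^'n^'n \<Rightarrow> bool" where
  "loewner_le X Y \<longleftrightarrow> (\<forall>\<xi>. \<xi> \<bullet> (X *v \<xi>) \<le> \<xi> \<bullet> (Y *v \<xi>))"

definition eigenvalues :: "real^'n^'n \<Rightarrow> real set" where
  "eigenvalues X = {\<mu>. \<exists>v. v \<noteq> 0 \<and> X *v v = \<mu> *\<^sub>R v}"

text \<open>Used for symmetric matrices only: there the set of real eigenvalues is finite and nonempty.\<close>

definition max_eigenvalue :: "real^'n^'n \<Rightarrow> real" where
  "max_eigenvalue X = Max (eigenvalues X)"

definition uniformly_convex :: "(real^'n) set \<Rightarrow> bool" where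
  "uniformly_convex \<Omega> \<longleftrightarrow> (\<exists>R>0. \<exists>Y. \<Omega> = (\<Inter>y\<in>Y. ball y R))"

definition usc_on :: "'a::topological_space set \<Rightarrow> ('a \<Rightarrow> real) \<Rightarrow> bool" where
  "usc_on S u \<longleftrightarrow> (\<forall>x\<in>S. \<forall>a>u x. \<forall>\<^sub>F y in at x within S. u y < a)"

definition lsc_on :: "'a::topological_space set \<Rightarrow> ('a \<Rightarrow> real) \<Rightarrow> bool" where
  "lsc_on S v \<longleftrightarrow> (\<forall>x\<in>S. \<forall>a<v x. \<forall>\<^sub>F y in at x within S. a < v y)"

definition Linfty_on :: "(real^'n) set \<Rightarrow> (real^'n \<Rightarrow> real) \<Rightarrow> bool" where
  "Linfty_on \<Omega> f \<longleftrightarrow> f \<in> borel_measurable (lebesgue_on \<Omega>) \<and>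
     (\<exists>C. AE x in lebesgue_on \<Omega>. \<bar>f x\<bar> \<le> C)"

definition gradient :: "(real^'n \<Rightarrow> real) \<Rightarrow> real^'n \<Rightarrow> real^'n" where
  "gradient \<psi> x = (\<chi> i. frechet_derivative \<psi> (at x) (axis i 1))"

definition hessian :: "(real^'n \<Rightarrow> real) \<Rightarrow> real^'n \<Rightarrow> real^'n^'n" where
  "hessian \<psi> x = jacobian (gradient \<psi>) (at x)"

text \<open>Intended for open \<open>\<Omega>\<close>, where differentiability within \<open>\<Omega>\<close> is differentiability at each
  point, and where \<^const>\<open>gradient\<close> and \<^const>\<open>hessian\<close> on \<open>\<Omega>\<close> depend only on the restriction
  of \<open>\<psi>\<close> to \<open>\<Omega>\<close>.\<close>

definition C2_on :: "(real^'n) set \<Rightarrow> (real^'n \<Rightarrow> real) \<Rightarrow> bool" where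
  "C2_on \<Omega> \<psi> \<longleftrightarrow> \<psi> differentiable_on \<Omega> \<and> gradient \<psi> differentiable_on \<Omega> \<and>
     continuous_on \<Omega> (hessian \<psi>)"

definition local_max_at :: "'a::topological_space set \<Rightarrow> ('a \<Rightarrow> real) \<Rightarrow> 'a \<Rightarrow> bool" where
  "local_max_at S g x0 \<longleftrightarrow> (\<forall>\<^sub>F x in at x0 within S. g x \<le> g x0)"

definition local_min_at :: "'a::topological_space set \<Rightarrow> ('a \<Rightarrow> real) \<Rightarrow> 'a \<Rightarrow> bool" where
  "local_min_at S g x0 \<longleftrightarrow> (\<forall>\<^sub>F x in at x0 within S. g x0 \<le> g x)"

text \<open>
  The problem is \<open>F(x, D\<^sup>2u) + H(Du) = f\<close> in \<open>\<Omega>\<close>, \<open>u = 0\<close> on \<open>\<partial>\<Omega>\<close>. Candidate functions are total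
  functions of which only the values on \<open>closure \<Omega>\<close> matter; \<open>F\<close> is only evaluated at symmetric
  matrices, since the Hessian of a \<open>C\<^sup>2\<close> function is symmetric.
\<close>

definition viscosity_subsolution ::
  "(real^'n) set \<Rightarrow> (real^'n \<Rightarrow> real^'n^'n \<Rightarrow> real) \<Rightarrow> (real^'n \<Rightarrow> real) \<Rightarrow> (real^'n \<Rightarrow> real)
    \<Rightarrow> (real^'n \<Rightarrow> real) \<Rightarrow> bool" where
  "viscosity_subsolution \<Omega> F H f u \<longleftrightarrow>
     usc_on (closure \<Omega>) u \<and> (\<forall>x\<in>frontier \<Omega>. u x \<le> 0) \<and>
     (\<forall>x0\<in>\<Omega>. \<forall>\<psi>. C2_on \<Omega> \<psi> \<and> local_max_at \<Omega> (\<lambda>x. u x - \<psi> x) x0 \<longrightarrow>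
        F x0 (hessian \<psi> x0) + H (gradient \<psi> x0) \<ge> f x0)"

definition viscosity_supersolution ::
  "(real^'n) set \<Rightarrow> (real^'n \<Rightarrow> real^'n^'n \<Rightarrow> real) \<Rightarrow> (real^'n \<Rightarrow> real) \<Rightarrow> (real^'n \<Rightarrow> real)
    \<Rightarrow> (real^'n \<Rightarrow> real) \<Rightarrow> bool" where
  "viscosity_supersolution \<Omega> F H f v \<longleftrightarrow>
     lsc_on (closure \<Omega>) v \<and> (\<forall>x\<in>frontier \<Omega>. v x \<ge> 0) \<and>
     (\<forall>x0\<in>\<Omega>. \<forall>\<psi>. C2_on \<Omega> \<psi> \<and> local_min_at \<Omega> (\<lambda>x. v x - \<psi> x) x0 \<longrightarrow>
        F x0 (hessian \<psi> x0) + H (gradient \<psi> x0) \<le> f x0)"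

definition strict_viscosity_supersolution ::
  "(real^'n) set \<Rightarrow> (real^'n \<Rightarrow> real^'n^'n \<Rightarrow> real) \<Rightarrow> (real^'n \<Rightarrow> real) \<Rightarrow> (real^'n \<Rightarrow> real)
    \<Rightarrow> (real^'n \<Rightarrow> real) \<Rightarrow> bool" where
  "strict_viscosity_supersolution \<Omega> F H f v \<longleftrightarrow>
     (\<exists>\<epsilon>>0. viscosity_supersolution \<Omega> F H (\<lambda>x. f x - \<epsilon>) v)"

definition viscosity_solution ::
  "(real^'n) set \<Rightarrow> (real^'n \<Rightarrow> real^'n^'n \<Rightarrow> real) \<Rightarrow> (real^'n \<Rightarrow> real) \<Rightarrow> (real^'n \<Rightarrow> real)
    \<Rightarrow> (real^'n \<Rightarrow> real) \<Rightarrow> bool" where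
  "viscosity_solution \<Omega> F H f u \<longleftrightarrow>
     continuous_on (closure \<Omega>) u \<and> viscosity_subsolution \<Omega> F H f u \<and>
     viscosity_supersolution \<Omega> F H f u"

end

theory Submission
  imports Defs "HOL-Real_Asymp.Real_Asymp"
begin

text \<open>
  If \<open>v\<close> is a supersolution and \<open>\<sigma> > 1\<close>, then \<open>\<sigma> v\<close> is a strict supersolution, by homogeneity of \<open>F\<close>,
  the scaling of \<open>H\<close> and \<open>sup f < 0\<close>; letting \<open>\<sigma>\<close> tend to 1, comparison with strict supersolutions
  becomes comparison with all supersolutions. Uniqueness follows, and existence is Perron's method:
  zero is a subsolution, and every subsolution lies below the barrier \<open>A (R\<^sup>2 - m(x)\<^sup>2) / 2\<close>, where
  \<open>m(x)\<close> is the largest distance from \<open>x\<close> to the centres of the balls defining \<open>\<Omega>\<close>. It vanishes on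
  the boundary, and for large \<open>A\<close> it is a supersolution because \<open>H\<close> grows sublinearly. The upper
  envelope \<open>U\<close> of the supremum of all subsolutions is then itself the largest subsolution, its lower
  envelope \<open>L\<close> is a supersolution, and comparison gives \<open>U \<le> L\<close>.
\<close>

subsection \<open>Gradients and Hessians\<close>

text \<open>The barrier is an infimum of paraboloids: \<open>- (m x)\<^sup>2\<close> is the least
  value of -|x - y|^2 over the closure of the set of centres. At every point one concave paraboloid
  with Hessian \<open>(- A) *\<^sub>R mat 1\<close> therefore lies above the barrier and touches it.
  Ellipticity yields -\<beta> A there, while the gradient has norm at most A R in the domain, so
  that H costs at most b (A R)^p + c; because p < 1, a large A wins. Ellipticity acts twice:
  quantitatively in the barrier, and as plain monotonicity of F in Perron's method. All hypotheses
  on F concern symmetric matrices only, whereas \<open>C2_on\<close> speaks of a differentiable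
  gradient with continuous derivative. The symmetry of the Hessian must therefore be established
  before F can be handled at a test function.\<close>

lemma has_derivative_gradient:
  fixes \<psi> :: "real^'n \<Rightarrow> real"
  assumes "\<psi> differentiable (at x)"
  shows "(\<psi> has_derivative (\<lambda>h. gradient \<psi> x \<bullet> h)) (at x)"
proof -
  let ?D = "frechet_derivative \<psi> (at x)"
  have D: "(\<psi> has_derivative ?D) (at x)"
    using assms frechet_derivative_works by blast
  then interpret bounded_linear ?D by (rule has_derivative_bounded_linear)
  have "?D h = gradient \<psi> x \<bullet> h" for h
  proof -
    have "?D h = ?D (\<Sum>i\<in>UNIV. h $ i *\<^sub>R axis i 1)"
      using basis_expansion[of h] by (simp add: scalar_mult_eq_scaleR)
    also have "\<dots> = gradient \<psi> x \<bullet> h"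
      by (simp add: sum scaleR inner_vec_def gradient_def mult.commute)
    finally show ?thesis .
  qed
  with D show ?thesis by (metis (no_types, lifting) ext)
qed

lemma C2_onD:
  fixes \<psi> :: "real^'n \<Rightarrow> real"
  assumes "open \<Omega>" "C2_on \<Omega> \<psi>" "x \<in> \<Omega>"
  shows "(\<psi> has_derivative (\<lambda>h. gradient \<psi> x \<bullet> h)) (at x)"
    and "(gradient \<psi> has_derivative (\<lambda>h. hessian \<psi> x *v h)) (at x)"
proof -
  have "\<psi> differentiable (at x)" "gradient \<psi> differentiable (at x)"
    using assms unfolding C2_on_def differentiable_on_def by (metis at_within_open)+
  then show "(\<psi> has_derivative (\<lambda>h. gradient \<psi> x \<bullet> h)) (at x)"
    and "(gradient \<psi> has_derivative (\<lambda>h. hessian \<psi> x *v h)) (at x)"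
    by (simp_all add: has_derivative_gradient hessian_def jacobian_works[symmetric])
qed

text \<open>\<open>gradient\<close> and \<open>hessian\<close> are built from
  \<open>frechet_derivative\<close> and \<open>jacobian\<close>; uniqueness of the derivative lets
  explicit candidates \<open>g\<close> and \<open>X\<close> determine them. Openness allows
  \<open>gradient \<psi>\<close> to be replaced by \<open>g\<close> near a point and hence to be
  differentiated there.\<close>

lemma
  fixes \<psi> :: "real^'n \<Rightarrow> real"
  assumes "open \<Omega>"
    and \<psi>: "\<And>x. x \<in> \<Omega> \<Longrightarrow> (\<psi> has_derivative (\<lambda>h. g x \<bullet> h)) (at x)"
    and g: "\<And>x. x \<in> \<Omega> \<Longrightarrow> (g has_derivative (\<lambda>h. X x *v h)) (at x)"
  shows gradient_eqI: "\<And>x. x \<in> \<Omega> \<Longrightarrow> gradient \<psi> x = g x"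
    and hessian_eqI: "\<And>x. x \<in> \<Omega> \<Longrightarrow> hessian \<psi> x = X x"
    and C2_onI: "continuous_on \<Omega> X \<Longrightarrow> C2_on \<Omega> \<psi>"
proof -
  show grad: "gradient \<psi> x = g x" if "x \<in> \<Omega>" for x
  proof -
    have "frechet_derivative \<psi> (at x) = (\<lambda>h. g x \<bullet> h)"
      using \<psi>[OF that] frechet_derivative_at by metis
    then show ?thesis by (simp add: gradient_def vec_eq_iff inner_axis)
  qed
  have gradX: "(gradient \<psi> has_derivative (\<lambda>h. X x *v h)) (at x)" if "x \<in> \<Omega>" for x
    using has_derivative_transform_within_open[OF g[OF that] \<open>open \<Omega>\<close> that] grad by simp
  show hess: "hessian \<psi> x = X x" if "x \<in> \<Omega>" for x
  proof -
    have "frechet_derivative (gradient \<psi>) (at x) = (\<lambda>h. X x *v h)"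
      using gradX[OF that] frechet_derivative_at by metis
    then show ?thesis by (simp add: hessian_def jacobian_def matrix_of_matrix_vector_mul)
  qed
  show "C2_on \<Omega> \<psi>" if "continuous_on \<Omega> X"
    unfolding C2_on_def differentiable_on_def
  proof (intro conjI ballI)
    show "\<psi> differentiable at x within \<Omega>" "gradient \<psi> differentiable at x within \<Omega>"
      if "x \<in> \<Omega>" for x
      using \<psi>[OF that] gradX[OF that] differentiableI differentiable_at_withinI by blast+
    show "continuous_on \<Omega> (hessian \<psi>)"
      using that hess continuous_on_cong by metis
  qed
qed

lemma
  fixes \<phi> \<psi> :: "real^'n \<Rightarrow> real"
  assumes "open \<Omega>" "C2_on \<Omega> \<phi>" "C2_on \<Omega> \<psi>"
  shows C2_on_add: "C2_on \<Omega> (\<lambda>x. \<phi> x + \<psi> x)"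
    and gradient_add: "x \<in> \<Omega> \<Longrightarrow> gradient (\<lambda>x. \<phi> x + \<psi> x) x = gradient \<phi> x + gradient \<psi> x"
    and hessian_add: "x \<in> \<Omega> \<Longrightarrow> hessian (\<lambda>x. \<phi> x + \<psi> x) x = hessian \<phi> x + hessian \<psi> x"
proof -
  note D = C2_onD[OF assms(1,2)] C2_onD[OF assms(1,3)]
  have 1: "((\<lambda>x. \<phi> x + \<psi> x) has_derivative (\<lambda>h. (gradient \<phi> x + gradient \<psi> x) \<bullet> h)) (at x)"
    and 2: "((\<lambda>x. gradient \<phi> x + gradient \<psi> x) has_derivative
      (\<lambda>h. (hessian \<phi> x + hessian \<psi> x) *v h)) (at x)" if "x \<in> \<Omega>" for x
    using that by (auto intro!: derivative_eq_intros D
        simp: inner_add_left matrix_vector_mult_add_rdistrib)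
  have 3: "continuous_on \<Omega> (\<lambda>x. hessian \<phi> x + hessian \<psi> x)"
    using assms(2,3) by (auto simp: C2_on_def intro!: continuous_intros)
  show "C2_on \<Omega> (\<lambda>x. \<phi> x + \<psi> x)"
    "x \<in> \<Omega> \<Longrightarrow> gradient (\<lambda>x. \<phi> x + \<psi> x) x = gradient \<phi> x + gradient \<psi> x"
    "x \<in> \<Omega> \<Longrightarrow> hessian (\<lambda>x. \<phi> x + \<psi> x) x = hessian \<phi> x + hessian \<psi> x"
    using C2_onI[OF assms(1) 1 2 3] gradient_eqI[OF assms(1) 1 2] hessian_eqI[OF assms(1) 1 2]
    by auto
qed

lemma
  fixes \<psi> :: "real^'n \<Rightarrow> real"
  assumes "open \<Omega>" "C2_on \<Omega> \<psi>"
  shows C2_on_scale: "C2_on \<Omega> (\<lambda>x. \<sigma> * \<psi> x)"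
    and gradient_scale: "x \<in> \<Omega> \<Longrightarrow> gradient (\<lambda>x. \<sigma> * \<psi> x) x = \<sigma> *\<^sub>R gradient \<psi> x"
    and hessian_scale: "x \<in> \<Omega> \<Longrightarrow> hessian (\<lambda>x. \<sigma> * \<psi> x) x = \<sigma> *\<^sub>R hessian \<psi> x"
proof -
  note D = C2_onD[OF assms]
  have 1: "((\<lambda>x. \<sigma> * \<psi> x) has_derivative (\<lambda>h. (\<sigma> *\<^sub>R gradient \<psi> x) \<bullet> h)) (at x)"
    and 2: "((\<lambda>x. \<sigma> *\<^sub>R gradient \<psi> x) has_derivative (\<lambda>h. (\<sigma> *\<^sub>R hessian \<psi> x) *v h)) (at x)"
    if "x \<in> \<Omega>" for x
    using that by (auto intro!: derivative_eq_intros D simp: scaleR_matrix_vector_assoc)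
  have 3: "continuous_on \<Omega> (\<lambda>x. \<sigma> *\<^sub>R hessian \<psi> x)"
    using assms(2) by (auto simp: C2_on_def intro!: continuous_intros)
  show "C2_on \<Omega> (\<lambda>x. \<sigma> * \<psi> x)"
    "x \<in> \<Omega> \<Longrightarrow> gradient (\<lambda>x. \<sigma> * \<psi> x) x = \<sigma> *\<^sub>R gradient \<psi> x"
    "x \<in> \<Omega> \<Longrightarrow> hessian (\<lambda>x. \<sigma> * \<psi> x) x = \<sigma> *\<^sub>R hessian \<psi> x"
    using C2_onI[OF assms(1) 1 2 3] gradient_eqI[OF assms(1) 1 2] hessian_eqI[OF assms(1) 1 2]
    by auto
qed

text \<open>These quadratics serve as perturbations of test functions and as the paraboloids of the
  barrier; with a = 0 and c = 0 they give the zero function. The factor 1/2 makes the Hessian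
  exactly a times the identity.\<close>

lemma
  fixes z :: "real^'n" and a c :: real
  defines "q \<equiv> \<lambda>x. a / 2 * ((x - z) \<bullet> (x - z)) + c"
  assumes "open \<Omega>"
  shows C2_on_quadratic: "C2_on \<Omega> q"
    and gradient_quadratic: "x \<in> \<Omega> \<Longrightarrow> gradient q x = a *\<^sub>R (x - z)"
    and hessian_quadratic: "x \<in> \<Omega> \<Longrightarrow> hessian q x = a *\<^sub>R mat 1"
proof -
  have 1: "(q has_derivative (\<lambda>h. (a *\<^sub>R (x - z)) \<bullet> h)) (at x)"
    and 2: "((\<lambda>x. a *\<^sub>R (x - z)) has_derivative (\<lambda>h. (a *\<^sub>R mat 1) *v h)) (at x)" for x
    unfolding q_def
    by (auto intro!: derivative_eq_intros
        simp: scaleR_matrix_vector_assoc[symmetric] inner_commute algebra_simps)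
  show "C2_on \<Omega> q" "x \<in> \<Omega> \<Longrightarrow> gradient q x = a *\<^sub>R (x - z)"
    "x \<in> \<Omega> \<Longrightarrow> hessian q x = a *\<^sub>R mat 1"
    using C2_onI[OF assms(2) 1 2] gradient_eqI[OF assms(2) 1 2] hessian_eqI[OF assms(2) 1 2]
    by auto
qed

section \<open>Symmetry of the Hessian and second-derivative tests\<close>

lemma has_real_derivative_along_line:
  fixes \<psi> :: "'a::real_inner \<Rightarrow> real"
  assumes "(\<psi> has_derivative (\<lambda>h. g \<bullet> h)) (at (x + t *\<^sub>R v))"
  shows "((\<lambda>t. \<psi> (x + t *\<^sub>R v)) has_real_derivative g \<bullet> v) (at t)"
proof -
  have "((\<lambda>t. x + t *\<^sub>R v) has_derivative (\<lambda>h. h *\<^sub>R v)) (at t)"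
    by (auto intro!: derivative_eq_intros)
  from has_derivative_compose[OF this assms] show ?thesis
    by (simp add: has_field_derivative_def mult_commute_abs)
qed

text \<open>The second difference on the left is symmetric in \<open>u\<close> and \<open>v\<close>, which forces the symmetry of the
  derivative \<open>A\<close> of the gradient \<open>g\<close>.\<close>

lemma symmetric_second_difference_bound:
  fixes \<psi> :: "real^'n \<Rightarrow> real" and A :: "real^'n^'n"
  assumes e: "0 \<le> e"
    and \<psi>: "\<And>y. dist x y < d \<Longrightarrow> (\<psi> has_derivative (\<lambda>h. g y \<bullet> h)) (at y)"
    and g: "\<And>y. dist x y < d \<Longrightarrow> norm (g y - g x - A *v (y - x)) \<le> e * norm (y - x)"
    and s: "0 < s" "s * (norm u + norm v) < d"
  shows "\<bar>\<psi> (x + s *\<^sub>R u + s *\<^sub>R v) - \<psi> (x + s *\<^sub>R u) - \<psi> (x + s *\<^sub>R v) + \<psi> x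
     - s\<^sup>2 * (v \<bullet> (A *v u))\<bar> \<le> 2 * e * s\<^sup>2 * (norm u + norm v)\<^sup>2"
proof -
  \<comment> \<open>\<open>G\<close> is the increment of \<open>\<psi>\<close> by
    \<open>s *\<^sub>R u\<close>, viewed along the direction \<open>v\<close>. The mean value
    theorem for \<open>G\<close> turns the second difference of \<open>\<psi>\<close> into a first
    difference of \<open>g\<close>, to which the expansion of \<open>g\<close> at \<open>x\<close>
    applies.\<close>
  define G where "G t = \<psi> (x + s *\<^sub>R u + t *\<^sub>R v) - \<psi> (x + t *\<^sub>R v)" for t
  define G' where "G' t = (g (x + s *\<^sub>R u + t *\<^sub>R v) - g (x + t *\<^sub>R v)) \<bullet> v" for t
  have n2: "norm (t *\<^sub>R v) \<le> s * (norm u + norm v)"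
    and n1: "norm (s *\<^sub>R u + t *\<^sub>R v) \<le> s * (norm u + norm v)" if "0 \<le> t" "t \<le> s" for t
  proof -
    have *: "norm (t *\<^sub>R v) \<le> s * norm v" using that by (simp add: mult_right_mono)
    then show "norm (t *\<^sub>R v) \<le> s * (norm u + norm v)"
      using s(1) by (simp add: distrib_left add_increasing)
    show "norm (s *\<^sub>R u + t *\<^sub>R v) \<le> s * (norm u + norm v)"
      using * s(1) by (intro norm_triangle_le) (simp add: distrib_left)
  qed
  have near: "dist x (x + s *\<^sub>R u + t *\<^sub>R v) < d" "dist x (x + t *\<^sub>R v) < d"
    if "0 \<le> t" "t \<le> s" for t
    using n1[OF that] n2[OF that] s(2) by (simp_all add: dist_commute[of x]) (simp_all add: dist_norm add.assoc)
  have "(G has_real_derivative G' t) (at t)" if "0 \<le> t" "t \<le> s" for t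
    unfolding G_def G'_def inner_diff_left
    by (intro DERIV_diff has_real_derivative_along_line \<psi> near[OF that])
  then obtain z where z: "0 < z" "z < s" "G s - G 0 = (s - 0) * G' z"
    using MVT2[OF s(1), of G G'] by auto
  define y1 y2 where "y1 = x + s *\<^sub>R u + z *\<^sub>R v" and "y2 = x + z *\<^sub>R v"
  \<comment> \<open>Since y1 - y2 = s u, the linear parts of the two expansions differ by s A u,
    which is the main term.\<close>
  have "G' z - s * (v \<bullet> (A *v u))
    = ((g y1 - g x - A *v (y1 - x)) - (g y2 - g x - A *v (y2 - x))) \<bullet> v"
    by (simp add: G'_def y1_def y2_def inner_commute[of v] algebra_simps
        matrix_vector_mult_scaleR matrix_vector_right_distrib)
  also have "\<bar>\<dots>\<bar> \<le> norm ((g y1 - g x - A *v (y1 - x)) - (g y2 - g x - A *v (y2 - x))) * norm v"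
    by (rule Cauchy_Schwarz_ineq2)
  also have "\<dots> \<le> (e * norm (y1 - x) + e * norm (y2 - x)) * norm v"
    using g[of y1] g[of y2] near[of z] z
    by (intro mult_right_mono order_trans[OF norm_triangle_ineq4 add_mono]) (auto simp: y1_def y2_def)
  also have "\<dots> \<le> (e * (s * (norm u + norm v)) + e * (s * (norm u + norm v))) * (norm u + norm v)"
    using n1[of z] n2[of z] z e
    by (intro mult_mono add_mono mult_left_mono) (auto simp: y1_def y2_def add.assoc)
  finally have "\<bar>G' z - s * (v \<bullet> (A *v u))\<bar> \<le> 2 * e * s * (norm u + norm v)\<^sup>2"
    by (simp add: power2_eq_square algebra_simps)
  then have "s * \<bar>G' z - s * (v \<bullet> (A *v u))\<bar> \<le> s * (2 * e * s * (norm u + norm v)\<^sup>2)"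
    using s(1) by (intro mult_left_mono) auto
  moreover have "s * \<bar>G' z - s * (v \<bullet> (A *v u))\<bar> = \<bar>G s - G 0 - s\<^sup>2 * (v \<bullet> (A *v u))\<bar>"
  proof -
    have "G s - G 0 - s\<^sup>2 * (v \<bullet> (A *v u)) = s * (G' z - s * (v \<bullet> (A *v u)))"
      using z(3) by (simp add: power2_eq_square right_diff_distrib)
    with s(1) show ?thesis by (simp add: abs_mult)
  qed
  ultimately show ?thesis
    by (simp add: G_def power2_eq_square algebra_simps)
qed

text \<open>Exchanging \<open>u\<close> and \<open>v\<close> leaves the second difference unchanged,
  so both bilinear values lie close to the same number. Dividing by \<open>s\<^sup>2\<close> leaves
  an error proportional to the arbitrary \<open>e\<close>.\<close>

lemma transpose_hessian:
  fixes \<psi> :: "real^'n \<Rightarrow> real"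
  assumes "open \<Omega>" "C2_on \<Omega> \<psi>" "x \<in> \<Omega>"
  shows "transpose (hessian \<psi> x) = hessian \<psi> x"
proof -
  let ?A = "hessian \<psi> x"
  have *: "\<bar>v \<bullet> (?A *v u) - u \<bullet> (?A *v v)\<bar> \<le> 4 * e * (norm u + norm v)\<^sup>2" if "e > 0" for u v e
  proof -
    obtain r where r: "r > 0" "ball x r \<subseteq> \<Omega>"
      using assms(1,3) open_contains_ball by blast
    obtain d' where d': "d' > 0" "\<And>y. norm (y - x) < d' \<Longrightarrow>
        norm (gradient \<psi> y - gradient \<psi> x - ?A *v (y - x)) \<le> e * norm (y - x)"
      using C2_onD(2)[OF assms] \<open>e > 0\<close> unfolding has_derivative_at_alt by blast
    define d where "d = min r d'"
    define K where "K = norm u + norm v"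
    \<comment> \<open>The summand 1 keeps the quotient meaningful when \<open>u\<close> and
      \<open>v\<close> are both zero.\<close>
    define s where "s = d / (2 * (K + 1))"
    have "d > 0" "K \<ge> 0" using r(1) d'(1) by (auto simp: d_def K_def)
    then have "s > 0" "s * (2 * (K + 1)) = d" "s * K \<ge> 0"
      unfolding s_def by simp_all
    then have s: "s > 0" "s * K < d"
      by (simp_all add: distrib_left)
    have "\<bar>v \<bullet> (?A *v u) - u \<bullet> (?A *v v)\<bar> * s\<^sup>2 \<le> (4 * e * K\<^sup>2) * s\<^sup>2"
    proof -
      have \<psi>: "dist x y < d \<Longrightarrow> (\<psi> has_derivative (\<lambda>h. gradient \<psi> y \<bullet> h)) (at y)" for y
        using r(2) C2_onD(1)[OF assms(1,2)] by (auto simp: d_def subset_iff)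
      have g: "dist x y < d \<Longrightarrow>
          norm (gradient \<psi> y - gradient \<psi> x - ?A *v (y - x)) \<le> e * norm (y - x)" for y
        using d'(2)[of y] by (simp add: d_def dist_norm norm_minus_commute[of x y])
      note B = symmetric_second_difference_bound[where g="gradient \<psi>" and A="?A" and x=x and \<psi>=\<psi>,
          OF less_imp_le[OF \<open>e > 0\<close>] \<psi> g s(1)]
      define \<Delta> where
        "\<Delta> = \<psi> (x + s *\<^sub>R u + s *\<^sub>R v) - \<psi> (x + s *\<^sub>R u) - \<psi> (x + s *\<^sub>R v) + \<psi> x"
      have "\<bar>\<Delta> - s\<^sup>2 * (v \<bullet> (?A *v u))\<bar> \<le> 2 * e * s\<^sup>2 * K\<^sup>2"
        using B[where u=u and v=v] s(2) by (simp add: K_def \<Delta>_def)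
      moreover have "\<bar>\<Delta> - s\<^sup>2 * (u \<bullet> (?A *v v))\<bar> \<le> 2 * e * s\<^sup>2 * K\<^sup>2"
        using B[where u=v and v=u] s(2) by (simp add: K_def \<Delta>_def algebra_simps)
      ultimately have "\<bar>s\<^sup>2 * (v \<bullet> (?A *v u)) - s\<^sup>2 * (u \<bullet> (?A *v v))\<bar> \<le> 4 * e * s\<^sup>2 * K\<^sup>2"
        by linarith
      moreover have "\<bar>s\<^sup>2 * (v \<bullet> (?A *v u)) - s\<^sup>2 * (u \<bullet> (?A *v v))\<bar>
          = \<bar>v \<bullet> (?A *v u) - u \<bullet> (?A *v v)\<bar> * s\<^sup>2"
        by (simp add: abs_mult mult.commute flip: right_diff_distrib)
      ultimately show ?thesis by (simp add: mult_ac)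
    qed
    then show ?thesis using s(1) by (simp add: K_def)
  qed
  have "v \<bullet> (?A *v u) - u \<bullet> (?A *v v) = 0" for u v
  proof (rule ccontr)
    let ?D = "\<bar>v \<bullet> (?A *v u) - u \<bullet> (?A *v v)\<bar>" and ?N = "(norm u + norm v)\<^sup>2"
    assume "\<not> ?thesis"
    then have "?D > 0" by simp
    \<comment> \<open>This \<open>e\<close> makes the bound \<open>4 * e * ?N\<close> smaller than
      half of \<open>?D\<close>.\<close>
    have "?D \<le> 4 * (?D / (8 * (?N + 1))) * ?N"
      using \<open>?D > 0\<close> by (intro *) (simp add: add_nonneg_pos)
    also have "\<dots> < ?D"
    proof -
      have "?D * ?N < 2 * ?D * (?N + 1)"
        using \<open>?D > 0\<close> by (intro mult_strict_mono) auto
      moreover have "?N + 1 > 0" by (simp add: add_nonneg_pos)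
      ultimately show ?thesis by (simp add: field_simps)
    qed
    finally show False by simp
  qed
  then have "(transpose ?A *v v - ?A *v v) \<bullet> u = 0" for u v
    by (simp add: inner_diff_left dot_lmul_matrix transpose_matrix_vector
        inner_commute[of "_ *v _"])
  then have "transpose ?A *v v = ?A *v v" for v
    by (metis eq_iff_diff_eq_0 inner_eq_zero_iff)
  then show ?thesis by (simp add: matrix_eq)
qed

text \<open>If the form were negative at \<xi>, the derivative along \<xi>, which vanishes at x,
  would be negative just after x, and the mean value theorem would produce values below \<psi> x.
  Only the differentiability of the gradient at x enters, not a second-order Taylor
  expansion.\<close>

lemma second_derivative_test_min:
  fixes \<psi> :: "real^'n \<Rightarrow> real"
  assumes "open \<Omega>" "C2_on \<Omega> \<psi>" "x \<in> \<Omega>" and min: "local_min_at \<Omega> \<psi> x"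
  shows "gradient \<psi> x = 0" and "0 \<le> \<xi> \<bullet> (hessian \<psi> x *v \<xi>)"
proof -
  have "\<forall>\<^sub>F y in at x. \<psi> x \<le> \<psi> y"
    using min at_within_open[OF assms(3,1)] by (simp add: local_min_at_def)
  then obtain d where d: "d > 0" "\<And>y. dist y x < d \<Longrightarrow> \<psi> x \<le> \<psi> y"
    unfolding eventually_at by (metis UNIV_I order_refl)
  have "(\<lambda>h. gradient \<psi> x \<bullet> h) = (\<lambda>h. 0)"
    by (rule differential_zero_maxmin[of x "ball x d", OF _ _ C2_onD(1)[OF assms(1-3)]])
      (use d in \<open>auto simp: dist_commute\<close>)
  then show 0: "gradient \<psi> x = 0"
    by (metis inner_eq_zero_iff)
  show "0 \<le> \<xi> \<bullet> (hessian \<psi> x *v \<xi>)"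
  proof (rule ccontr)
    assume neg: "\<not> ?thesis"
    then have "\<xi> \<noteq> 0" by auto
    obtain r where r: "r > 0" "ball x r \<subseteq> \<Omega>"
      using assms(1,3) open_contains_ball by blast
    let ?g = "\<lambda>t. gradient \<psi> (x + t *\<^sub>R \<xi>) \<bullet> \<xi>"
    have "((\<lambda>t. gradient \<psi> (x + t *\<^sub>R \<xi>)) has_derivative (\<lambda>h. hessian \<psi> x *v (h *\<^sub>R \<xi>))) (at 0)"
      by (rule has_derivative_compose[where g="gradient \<psi>"])
        (auto intro!: derivative_eq_intros C2_onD(2)[OF assms(1-3)])
    then have "(?g has_real_derivative \<xi> \<bullet> (hessian \<psi> x *v \<xi>)) (at 0)"
      unfolding has_field_derivative_def
      by (auto intro!: derivative_eq_intros simp: matrix_vector_mult_scaleR inner_commute mult.commute)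
    from DERIV_neg_dec_right[OF this] neg obtain e
      where e: "e > 0" "\<And>h. 0 < h \<Longrightarrow> h < e \<Longrightarrow> ?g h < 0"
      using 0 by auto
    define s where "s = min (e / 2) (min r d / (2 * norm \<xi>))"
    have s: "s > 0" "s < e" using e(1) r(1) d(1) \<open>\<xi> \<noteq> 0\<close> by (auto simp: s_def)
    have near: "t * norm \<xi> < min r d" if "0 \<le> t" "t \<le> s" for t
    proof -
      have "t * norm \<xi> \<le> min r d / (2 * norm \<xi>) * norm \<xi>"
        using that by (intro mult_right_mono) (auto simp: s_def)
      also have "\<dots> < min r d" using r(1) d(1) \<open>\<xi> \<noteq> 0\<close> by (simp add: min_def)
      finally show ?thesis .
    qed
    have "((\<lambda>t. \<psi> (x + t *\<^sub>R \<xi>)) has_real_derivative ?g t) (at t)" if "0 \<le> t" "t \<le> s" for t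
    proof -
      have "x + t *\<^sub>R \<xi> \<in> \<Omega>" using near[OF that] r(2) that(1) by (auto simp: subset_iff dist_norm)
      then show ?thesis
        by (intro has_real_derivative_along_line C2_onD(1)[OF assms(1,2)])
    qed
    from MVT2[OF s(1) this] obtain z
      where z: "0 < z" "z < s" "\<psi> (x + s *\<^sub>R \<xi>) - \<psi> x = s * ?g z"
      by auto
    moreover have "?g z < 0" using e(2)[of z] z s by auto
    moreover have "\<psi> x \<le> \<psi> (x + s *\<^sub>R \<xi>)"
      using d(2) near[of s] s(1) by (simp add: dist_norm)
    ultimately show False using s(1) by (metis diff_ge_0_iff_ge mult_pos_neg not_le)
  qed
qed

text \<open>The bridge from classical to viscosity inequalities: where a test function touches a
  smooth function, the gradients agree and the Hessians are ordered, so ellipticity of F applies. It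
  serves the zero function, the glued function in Perron's method and the paraboloids of the
  barrier.\<close>

lemma second_derivative_test_diff:
  fixes \<phi> \<psi> :: "real^'n \<Rightarrow> real"
  assumes "open \<Omega>" "C2_on \<Omega> \<phi>" "C2_on \<Omega> \<psi>" "x \<in> \<Omega>"
    and "local_max_at \<Omega> (\<lambda>x. \<phi> x - \<psi> x) x"
  shows "gradient \<phi> x = gradient \<psi> x" and "loewner_le (hessian \<phi> x) (hessian \<psi> x)"
proof -
  note neg = C2_on_scale[OF assms(1,2), of "-1"]
  have "C2_on \<Omega> (\<lambda>x. \<psi> x + (-1) * \<phi> x)"
    by (rule C2_on_add[OF assms(1,3) neg])
  moreover have "local_min_at \<Omega> (\<lambda>x. \<psi> x + (-1) * \<phi> x) x"
    using assms(5) by (auto simp: local_max_at_def local_min_at_def elim: eventually_mono)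
  ultimately have "gradient (\<lambda>x. \<psi> x + (-1) * \<phi> x) x = 0"
    and H: "0 \<le> \<xi> \<bullet> (hessian (\<lambda>x. \<psi> x + (-1) * \<phi> x) x *v \<xi>)" for \<xi>
    using second_derivative_test_min[OF assms(1) _ assms(4)] by blast+
  then show "gradient \<phi> x = gradient \<psi> x"
    using gradient_add[OF assms(1,3) neg assms(4)] gradient_scale[OF assms(1,2,4), of "-1"] by simp
  show "loewner_le (hessian \<phi> x) (hessian \<psi> x)"
    using H hessian_add[OF assms(1,3) neg assms(4)] hessian_scale[OF assms(1,2,4), of "-1"]
    by (simp add: loewner_le_def matrix_vector_mult_diff_rdistrib inner_diff_right)
qed

subsection \<open>The largest eigenvalue of a symmetric matrix\<close>

text \<open>The form attains its minimum 0 at \<open>v\<close>. A short step from \<open>v\<close>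
  along -\<open>P *v v\<close> would decrease it to first order, below zero if \<open>P *v v\<close>
  did not vanish.\<close>

lemma psd_null_vector:
  fixes P :: "real^'n^'n"
  assumes sym: "transpose P = P" and psd: "\<And>w. 0 \<le> w \<bullet> (P *v w)" and v: "v \<bullet> (P *v v) = 0"
  shows "P *v v = 0"
proof (rule ccontr)
  assume *: "P *v v \<noteq> 0"
  define w where "w = P *v v"
  define q where "q = w \<bullet> (P *v w)"
  define t where "t = (w \<bullet> w) / (q + 1)"
  have "q \<ge> 0" "w \<bullet> w > 0" using psd * by (auto simp: q_def w_def)
  then have t: "t > 0" "t * q < w \<bullet> w" by (auto simp: t_def field_simps)
  have "v \<bullet> (P *v w) = w \<bullet> w"
    by (metis dot_lmul_matrix sym transpose_matrix_vector w_def inner_commute)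
  then have "(v - t *\<^sub>R w) \<bullet> (P *v (v - t *\<^sub>R w)) = t * (t * q - 2 * (w \<bullet> w))"
    using v by (simp add: q_def w_def[symmetric] inner_diff_left inner_diff_right algebra_simps
        matrix_vector_mult_diff_distrib matrix_vector_mult_scaleR)
  also have "\<dots> < 0" using t \<open>w \<bullet> w > 0\<close> by (intro mult_pos_neg) linarith+
  finally show False using psd by (metis not_le)
qed

text \<open>Eigenvectors for distinct eigenvalues are orthogonal, hence independent. Together with
  nonemptiness this gives \<open>Max\<close> in \<open>max_eigenvalue\<close> its intended
  meaning.\<close>

lemma finite_eigenvalues:
  fixes X :: "real^'n^'n"
  assumes sym: "transpose X = X"
  shows "finite (eigenvalues X)"
proof -
  define e where "e \<mu> = (SOME v. v \<noteq> 0 \<and> X *v v = \<mu> *\<^sub>R v)" for \<mu>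
  have e: "e \<mu> \<noteq> 0" "X *v e \<mu> = \<mu> *\<^sub>R e \<mu>" if "\<mu> \<in> eigenvalues X" for \<mu>
    using someI_ex[of "\<lambda>v. v \<noteq> 0 \<and> X *v v = \<mu> *\<^sub>R v"] that
    by (auto simp: e_def eigenvalues_def)
  have orth: "e \<mu> \<bullet> e \<nu> = 0" if "\<mu> \<in> eigenvalues X" "\<nu> \<in> eigenvalues X" "\<mu> \<noteq> \<nu>" for \<mu> \<nu>
  proof -
    have "(X *v e \<mu>) \<bullet> e \<nu> = e \<mu> \<bullet> (X *v e \<nu>)"
      by (metis dot_lmul_matrix sym transpose_matrix_vector)
    then have "\<mu> * (e \<mu> \<bullet> e \<nu>) = \<nu> * (e \<mu> \<bullet> e \<nu>)" using e that by simp
    with that show ?thesis by simp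
  qed
  then have "inj_on e (eigenvalues X)"
    using e(1) by (metis inj_onI inner_eq_zero_iff)
  moreover have "independent (e ` eigenvalues X)"
    using orth e(1) by (intro pairwise_orthogonal_independent)
      (auto simp: pairwise_def orthogonal_def)
  then have "finite (e ` eigenvalues X)"
    using independent_bound by blast
  ultimately show ?thesis by (rule finite_imageD[rotated])
qed

text \<open>The maximum M of the Rayleigh quotient over the unit sphere is an eigenvalue: M I - X is
  positive semidefinite and its form vanishes at a maximiser, which is then a null vector.\<close>

lemma eigenvalues_nonempty:
  fixes X :: "real^'n^'n"
  assumes sym: "transpose X = X"
  shows "eigenvalues X \<noteq> {}"
proof -
  have "compact (sphere 0 1 :: (real^'n) set)" "sphere 0 1 \<noteq> ({} :: (real^'n) set)"
    by auto
  moreover have "continuous_on (sphere 0 1) (\<lambda>v. v \<bullet> (X *v v))"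
    by (intro continuous_intros matrix_vector_mult_linear_continuous_on)
  ultimately obtain v where v: "norm v = 1"
    and max: "\<And>w. norm w = 1 \<Longrightarrow> w \<bullet> (X *v w) \<le> v \<bullet> (X *v v)"
    using continuous_attains_sup[of "sphere 0 1 :: (real^'n) set" "\<lambda>v. v \<bullet> (X *v v)"] by auto
  define M where "M = v \<bullet> (X *v v)"
  define P where "P = M *\<^sub>R mat 1 - X"
  have P: "w \<bullet> (P *v w) = M * (w \<bullet> w) - w \<bullet> (X *v w)" for w
    by (simp add: P_def matrix_vector_mult_diff_rdistrib scaleR_matrix_vector_assoc[symmetric]
        inner_diff_right)
  have "0 \<le> w \<bullet> (P *v w)" for w
  proof (cases "w = 0")
    case False
    then have "(w /\<^sub>R norm w) \<bullet> (X *v (w /\<^sub>R norm w)) \<le> M"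
      using max[of "w /\<^sub>R norm w"] by (simp add: M_def)
    then have "w \<bullet> (X *v w) / (norm w)\<^sup>2 \<le> M"
      by (simp add: matrix_vector_mult_scaleR power2_eq_square divide_inverse algebra_simps)
    with False show ?thesis
      by (simp add: P power2_norm_eq_inner[symmetric] field_simps)
  qed simp
  moreover have "transpose P = P"
    using sym by (simp add: P_def transpose_def vec_eq_iff mat_def)
  moreover have "v \<bullet> (P *v v) = 0"
    using v by (simp add: P M_def norm_eq_1)
  ultimately have "P *v v = 0" by (intro psd_null_vector)
  then have "X *v v = M *\<^sub>R v"
    by (simp add: P_def matrix_vector_mult_diff_rdistrib scaleR_matrix_vector_assoc[symmetric])
  moreover have "v \<noteq> 0" using v by auto
  ultimately show ?thesis by (auto simp: eigenvalues_def)
qed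

lemma max_eigenvalue_le:
  fixes X :: "real^'n^'n"
  assumes "X \<in> sym_matrices" "loewner_le X (M *\<^sub>R mat 1)"
  shows "max_eigenvalue X \<le> M"
proof -
  have sym: "transpose X = X" using assms(1) by (simp add: sym_matrices_def)
  have "\<mu> \<le> M" if "\<mu> \<in> eigenvalues X" for \<mu>
  proof -
    obtain v where v: "v \<noteq> 0" "X *v v = \<mu> *\<^sub>R v"
      using \<open>\<mu> \<in> eigenvalues X\<close> by (auto simp: eigenvalues_def)
    have "v \<bullet> (X *v v) \<le> v \<bullet> ((M *\<^sub>R mat 1) *v v)"
      using assms(2) by (simp add: loewner_le_def)
    with v show ?thesis by (simp add: scaleR_matrix_vector_assoc[symmetric])
  qed
  then show ?thesis
    unfolding max_eigenvalue_def
    using Max_in[OF finite_eigenvalues[OF sym] eigenvalues_nonempty[OF sym]] by blast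
qed

subsection \<open>Semicontinuous functions\<close>

lemma usc_on_subset: "usc_on S u \<Longrightarrow> T \<subseteq> S \<Longrightarrow> usc_on T u"
  unfolding usc_on_def by (meson at_le filter_leD subsetD)

lemma usc_on_iff_nhds:
  fixes u :: "'a::metric_space \<Rightarrow> real"
  shows "usc_on S u \<longleftrightarrow>
    (\<forall>x\<in>S. \<forall>a>u x. \<exists>r>0. \<forall>y\<in>S. dist x y < r \<longrightarrow> u y < a)"
proof
  show "usc_on S u" if "\<forall>x\<in>S. \<forall>a>u x. \<exists>r>0. \<forall>y\<in>S. dist x y < r \<longrightarrow> u y < a"
    using that unfolding usc_on_def eventually_at by (simp add: dist_commute) blast
  show "\<forall>x\<in>S. \<forall>a>u x. \<exists>r>0. \<forall>y\<in>S. dist x y < r \<longrightarrow> u y < a" if "usc_on S u"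
  proof (intro ballI allI impI)
    fix x a assume "x \<in> S" "u x < a"
    then obtain r where "r > 0" "\<forall>y\<in>S. y \<noteq> x \<and> dist y x < r \<longrightarrow> u y < a"
      using \<open>usc_on S u\<close> unfolding usc_on_def eventually_at by blast
    then have "\<forall>y\<in>S. dist x y < r \<longrightarrow> u y < a"
      using \<open>u x < a\<close> by (auto simp: dist_commute)
    with \<open>r > 0\<close> show "\<exists>r>0. \<forall>y\<in>S. dist x y < r \<longrightarrow> u y < a" by blast
  qed
qed

lemma lsc_on_iff_usc_on_minus: "lsc_on S v \<longleftrightarrow> usc_on S (\<lambda>x. - v x)"
proof
  show "usc_on S (\<lambda>x. - v x)" if "lsc_on S v"
    unfolding usc_on_def
  proof (intro ballI allI impI)
    fix x a assume "x \<in> S" "- v x < a"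
    then have "\<forall>\<^sub>F y in at x within S. - a < v y"
      using that by (simp add: lsc_on_def minus_less_iff)
    then show "\<forall>\<^sub>F y in at x within S. - v y < a"
      by (simp add: minus_less_iff)
  qed
  show "lsc_on S v" if "usc_on S (\<lambda>x. - v x)"
    unfolding lsc_on_def
  proof (intro ballI allI impI)
    fix x a assume "x \<in> S" "a < v x"
    then have "\<forall>\<^sub>F y in at x within S. - v y < - a"
      using \<open>usc_on S (\<lambda>x. - v x)\<close> unfolding usc_on_def by (metis neg_less_iff_less)
    then show "\<forall>\<^sub>F y in at x within S. a < v y"
      by simp
  qed
qed

lemma continuous_on_imp_usc_on: "continuous_on S u \<Longrightarrow> usc_on S u"
  unfolding usc_on_def continuous_on by (auto intro: order_tendstoD)

lemma continuous_on_imp_lsc_on: "continuous_on S u \<Longrightarrow> lsc_on S u"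
  unfolding lsc_on_def continuous_on by (auto intro: order_tendstoD)

lemma usc_lsc_on_imp_continuous_on: "usc_on S u \<Longrightarrow> lsc_on S u \<Longrightarrow> continuous_on S u"
  unfolding usc_on_def lsc_on_def continuous_on by (auto intro: order_tendstoI)

lemma usc_on_cong:
  assumes "\<And>x. x \<in> S \<Longrightarrow> u x = v x"
  shows "usc_on S u \<longleftrightarrow> usc_on S v"
proof -
  have "(\<forall>\<^sub>F y in at x within S. u y < a) \<longleftrightarrow> (\<forall>\<^sub>F y in at x within S. v y < a)" for x a
    using assms by (auto simp: eventually_at_filter elim!: eventually_mono)
  then show ?thesis using assms by (auto simp: usc_on_def)
qed

lemma usc_on_add:
  assumes "usc_on S u" "usc_on S v"
  shows "usc_on S (\<lambda>x. u x + v x)"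
  unfolding usc_on_def
proof (intro ballI allI impI)
  fix x a assume "x \<in> S" and a: "u x + v x < a"
  define e where "e = (a - u x - v x) / 2"
  have "e > 0" using a by (simp add: e_def)
  then have "\<forall>\<^sub>F y in at x within S. u y < u x + e" "\<forall>\<^sub>F y in at x within S. v y < v x + e"
    using assms \<open>x \<in> S\<close> by (auto simp: usc_on_def)
  then show "\<forall>\<^sub>F y in at x within S. u y + v y < a"
    by eventually_elim (simp add: e_def field_simps)
qed

text \<open>Without a maximum, every x has a strictly larger value u (m x), which still exceeds u
  near x. Among the finitely many centres of a subcover choose one with u (m x) largest; m x itself
  lies in one of the covering balls, so its value is below another u (m y), a contradiction.\<close>

lemma usc_on_attains_max:
  fixes u :: "'a::metric_space \<Rightarrow> real"
  assumes "compact K" "K \<noteq> {}" "usc_on K u"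
  obtains x where "x \<in> K" "\<And>y. y \<in> K \<Longrightarrow> u y \<le> u x"
proof (rule ccontr)
  assume "\<not> thesis"
  then have "\<forall>x\<in>K. \<exists>y\<in>K. u x < u y" using that by (meson not_le)
  then obtain m where m: "\<And>x. x \<in> K \<Longrightarrow> m x \<in> K \<and> u x < u (m x)" by metis
  then have "\<forall>x\<in>K. \<exists>r>0. \<forall>y\<in>K. dist x y < r \<longrightarrow> u y < u (m x)"
    using assms(3) unfolding usc_on_iff_nhds by blast
  then obtain r where r: "\<And>x. x \<in> K \<Longrightarrow> r x > 0"
    "\<And>x y. x \<in> K \<Longrightarrow> y \<in> K \<Longrightarrow> dist x y < r x \<Longrightarrow> u y < u (m x)"
    by metis
  have "K \<subseteq> (\<Union>x\<in>K. ball x (r x))" using r(1) by force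
  then obtain C where C: "C \<subseteq> K" "finite C" "K \<subseteq> (\<Union>x\<in>C. ball x (r x))"
    using compactE_image[OF assms(1), of K "\<lambda>x. ball x (r x)"] by auto
  then have "C \<noteq> {}" using assms(2) by auto
  then have "Max ((\<lambda>x. u (m x)) ` C) \<in> (\<lambda>x. u (m x)) ` C"
    using C(2) by (intro Max_in) auto
  then obtain x where "x \<in> C" "Max ((\<lambda>x. u (m x)) ` C) = u (m x)"
    by blast
  moreover have "u (m y) \<le> Max ((\<lambda>x. u (m x)) ` C)" if "y \<in> C" for y
    using C(2) that by (intro Max_ge) auto
  ultimately have x: "x \<in> C" "\<And>y. y \<in> C \<Longrightarrow> u (m y) \<le> u (m x)"
    by auto
  then have "m x \<in> K" using C(1) m by auto
  then obtain y where "y \<in> C" "dist y (m x) < r y" using C(3) by auto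
  then have "u (m x) < u (m y)" using r(2) C(1) \<open>m x \<in> K\<close> by blast
  with x(2)[OF \<open>y \<in> C\<close>] show False by simp
qed

text \<open>The envelope is the limit of suprema over shrinking balls. The last conclusion, that its
  values are nearly attained by \<open>u\<close> arbitrarily close by, stands in for minimality
  among semicontinuous majorants and is the form that the limit arguments use.\<close>

lemma usc_envelope:
  fixes u :: "'a::metric_space \<Rightarrow> real"
  assumes lb: "\<And>x. x \<in> S \<Longrightarrow> m \<le> u x" and ub: "\<And>x. x \<in> S \<Longrightarrow> u x \<le> M"
  obtains U where "usc_on S U" "\<And>x. x \<in> S \<Longrightarrow> u x \<le> U x"
    "\<And>x e r. x \<in> S \<Longrightarrow> e > 0 \<Longrightarrow> r > 0 \<Longrightarrow> \<exists>y\<in>S. dist x y < r \<and> U x - e < u y"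
proof
  define s where "s x r = (SUP y\<in>S \<inter> ball x r. u y)" for x r
  define U where "U x = (INF r\<in>{0<..}. s x r)" for x
  have bdd: "bdd_above (u ` (S \<inter> B))" for B
    using ub by (intro bdd_aboveI[of _ M]) auto
  have le_s: "u y \<le> s x r" if "y \<in> S" "dist x y < r" for x y r
    unfolding s_def by (intro cSUP_upper bdd) (use that in auto)
  have bdd_s: "bdd_below (s x ` {0<..})" if "x \<in> S" for x
    using le_s[OF that, of x] lb[OF that] by (intro bdd_belowI2[of _ m]) force
  have U_le: "U x \<le> s x r" if "x \<in> S" "r > 0" for x r
    unfolding U_def by (intro cINF_lower bdd_s) (use that in auto)
  show "u x \<le> U x" if "x \<in> S" for x
    unfolding U_def by (intro cINF_greatest) (use le_s[of x x] that in auto)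
  show "usc_on S U"
    unfolding usc_on_iff_nhds
  proof (intro ballI allI impI)
    fix x a assume "x \<in> S" "U x < a"
    then obtain r where r: "r > 0" "s x r < a"
      using cINF_less_iff[OF _ bdd_s, of x a] by (auto simp: U_def)
    have "U y < a" if "y \<in> S" "dist x y < r" for y
    proof -
      have "U y \<le> s y (r - dist x y)" using that by (intro U_le) auto
      also have "\<dots> \<le> s x r" unfolding s_def
      proof (intro cSUP_subset_mono bdd order_refl)
        show "S \<inter> ball y (r - dist x y) \<noteq> {}" using that by auto
        show "S \<inter> ball y (r - dist x y) \<subseteq> S \<inter> ball x r"
        proof
          fix z assume "z \<in> S \<inter> ball y (r - dist x y)"
          then show "z \<in> S \<inter> ball x r" using dist_triangle[of x z y] by simp
        qed
      qed
      finally show ?thesis using r(2) by simp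
    qed
    with r(1) show "\<exists>r>0. \<forall>y\<in>S. dist x y < r \<longrightarrow> U y < a" by blast
  qed
  show "\<exists>y\<in>S. dist x y < r \<and> U x - e < u y" if "x \<in> S" "e > 0" "r > 0" for x e r
  proof -
    have "U x - e < s x r" using U_le[of x r] that by simp
    moreover have "S \<inter> ball x r \<noteq> {}" using that by auto
    ultimately have "\<exists>y\<in>S \<inter> ball x r. U x - e < u y"
      using less_cSUP_iff[OF _ bdd, of "ball x r" "U x - e"] by (auto simp: s_def)
    then show ?thesis by auto
  qed
qed

lemma lsc_envelope:
  fixes u :: "'a::metric_space \<Rightarrow> real"
  assumes "\<And>x. x \<in> S \<Longrightarrow> m \<le> u x" "\<And>x. x \<in> S \<Longrightarrow> u x \<le> M"
  obtains L where "lsc_on S L" "\<And>x. x \<in> S \<Longrightarrow> L x \<le> u x"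
    "\<And>x e r. x \<in> S \<Longrightarrow> e > 0 \<Longrightarrow> r > 0 \<Longrightarrow> \<exists>y\<in>S. dist x y < r \<and> u y < L x + e"
proof -
  have "- M \<le> - u x" "- u x \<le> - m" if "x \<in> S" for x
    using assms that by auto
  then show thesis
  proof (rule usc_envelope)
    fix U assume U: "usc_on S U" "\<And>x. x \<in> S \<Longrightarrow> - u x \<le> U x"
      "\<And>x e r. x \<in> S \<Longrightarrow> e > 0 \<Longrightarrow> r > 0 \<Longrightarrow> \<exists>y\<in>S. dist x y < r \<and> U x - e < - u y"
    show thesis
    proof (rule that[of "\<lambda>x. - U x"])
      show "lsc_on S (\<lambda>x. - U x)" using U(1) by (simp add: lsc_on_iff_usc_on_minus)
      show "- U x \<le> u x" if "x \<in> S" for x using U(2)[OF that] by simp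
      show "\<exists>y\<in>S. dist x y < r \<and> u y < - U x + e" if "x \<in> S" "e > 0" "r > 0" for x e r
      proof -
        obtain y where "y \<in> S" "dist x y < r" "U x - e < - u y"
          using U(3)[OF \<open>x \<in> S\<close> \<open>e > 0\<close> \<open>r > 0\<close>] by blast
        then show ?thesis by (intro bexI[of _ y]) auto
      qed
    qed
  qed
qed

text \<open>The set where |f| exceeds an essential bound is open and null, hence empty. A pointwise
  bound gives the supremum of f its intended meaning and bounds f from below for the
  barrier.\<close>

lemma Linfty_on_continuous_imp_bounded:
  fixes f :: "real^'n \<Rightarrow> real"
  assumes "open \<Omega>" "continuous_on \<Omega> f" "Linfty_on \<Omega> f"
  obtains C where "\<And>x. x \<in> \<Omega> \<Longrightarrow> \<bar>f x\<bar> \<le> C"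
proof -
  obtain C where C: "AE x in lebesgue_on \<Omega>. \<bar>f x\<bar> \<le> C"
    using assms(3) by (auto simp: Linfty_on_def)
  have meas: "\<Omega> \<in> sets lebesgue" using assms(1) by (simp add: borel_open)
  let ?B = "{x \<in> \<Omega>. C < \<bar>f x\<bar>}"
  have "open (\<Omega> \<inter> (\<lambda>x. \<bar>f x\<bar>) -` {C<..})"
    using assms(1,2) by (intro continuous_open_preimage continuous_intros) auto
  then have "open ?B" by (simp add: Int_def vimage_def)
  moreover have "AE x in lebesgue. x \<in> \<Omega> \<longrightarrow> \<bar>f x\<bar> \<le> C"
    using C meas by (simp add: AE_restrict_space_iff)
  then have "AE x\<in>?B in lebesgue. x \<in> {}" by eventually_elim auto
  ultimately have "?B = {}" using mem_closed_if_AE_lebesgue_open[of ?B "{}"] by blast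
  with that[of C] show thesis by force
qed

subsection \<open>Perron's method\<close>

lemma local_max_atI:
  assumes "open B" "x \<in> B" "\<And>y. y \<in> B \<Longrightarrow> y \<in> S \<Longrightarrow> g y \<le> g x"
  shows "local_max_at S g x"
  unfolding local_max_at_def eventually_at_topological using assms by blast

lemma local_max_atE:
  fixes x :: "'a::metric_space"
  assumes "local_max_at S g x"
  obtains r where "r > 0" "\<And>y. y \<in> S \<Longrightarrow> dist x y < r \<Longrightarrow> g y \<le> g x"
proof -
  obtain r where "r > 0" "\<forall>y\<in>S. y \<noteq> x \<and> dist y x < r \<longrightarrow> g y \<le> g x"
    using assms unfolding local_max_at_def eventually_at by blast
  then show thesis by (intro that[of r]) (auto simp: dist_commute)
qed

lemma local_min_at_iff_local_max_at_minus: "local_min_at S g x \<longleftrightarrow> local_max_at S (\<lambda>y. - g y) x"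
  by (simp add: local_min_at_def local_max_at_def)

lemma local_max_at_mono:
  assumes "local_max_at S g x" "\<And>y. y \<in> S \<Longrightarrow> h y \<le> g y" "h x = g x"
  shows "local_max_at S h x"
proof -
  have "\<forall>\<^sub>F y in at x within S. y \<in> S" by (simp add: eventually_at_filter)
  with assms(1) show ?thesis
    unfolding local_max_at_def by eventually_elim (use assms(2,3) in force)
qed

lemma zero_sym_matrices: "0 \<in> sym_matrices"
  by (simp add: sym_matrices_def transpose_def vec_eq_iff)

lemma hessian_sym:
  "open \<Omega> \<Longrightarrow> C2_on \<Omega> \<psi> \<Longrightarrow> x \<in> \<Omega> \<Longrightarrow> hessian \<psi> x \<in> sym_matrices"
  by (simp add: sym_matrices_def transpose_hessian)

text \<open>The two envelopes of Perron's method are total functions that are shown to agree only on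
  \<open>closure \<Omega>\<close>; this carries the supersolution property from one to the
  other.\<close>

lemma viscosity_supersolution_cong:
  assumes "\<And>x. x \<in> closure \<Omega> \<Longrightarrow> v x = w x" and v: "viscosity_supersolution \<Omega> F H f v"
  shows "viscosity_supersolution \<Omega> F H f w"
  unfolding viscosity_supersolution_def
proof (intro conjI ballI allI impI)
  have "usc_on (closure \<Omega>) (\<lambda>x. - v x)"
    using v by (simp add: viscosity_supersolution_def lsc_on_iff_usc_on_minus)
  then show "lsc_on (closure \<Omega>) w"
    unfolding lsc_on_iff_usc_on_minus using assms(1) by (subst (asm) usc_on_cong) auto
  show "0 \<le> w x" if "x \<in> frontier \<Omega>" for x
  proof -
    have "v x = w x" using that by (intro assms(1)) (simp add: frontier_def)
    then show ?thesis using v that by (auto simp: viscosity_supersolution_def)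
  qed
  fix x0 \<psi> assume x0: "x0 \<in> \<Omega>" and "C2_on \<Omega> \<psi> \<and> local_min_at \<Omega> (\<lambda>x. w x - \<psi> x) x0"
  then have \<psi>: "C2_on \<Omega> \<psi>" and max: "local_max_at \<Omega> (\<lambda>x. - (w x - \<psi> x)) x0"
    by (auto simp: local_min_at_iff_local_max_at_minus)
  have "v x = w x" if "x \<in> \<Omega>" for x
    using assms(1) subsetD[OF closure_subset that] .
  then have "local_min_at \<Omega> (\<lambda>x. v x - \<psi> x) x0"
    unfolding local_min_at_iff_local_max_at_minus
    using x0 by (intro local_max_at_mono[OF max]) auto
  with \<psi> have "C2_on \<Omega> \<psi> \<and> local_min_at \<Omega> (\<lambda>x. v x - \<psi> x) x0" ..
  then show "F x0 (hessian \<psi> x0) + H (gradient \<psi> x0) \<le> f x0"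
    using v x0 unfolding viscosity_supersolution_def by blast
qed

text \<open>The setting of Perron's method: continuity and monotonicity in the matrix argument.
  Comparison enters later only through an upper bound for all subsolutions.\<close>

locale degenerate_elliptic =
  fixes \<Omega> :: "(real^'n) set" and F :: "real^'n \<Rightarrow> real^'n^'n \<Rightarrow> real"
    and H f :: "real^'n \<Rightarrow> real"
  assumes open_domain: "open \<Omega>"
    and F_cont: "continuous_on (\<Omega> \<times> sym_matrices) (\<lambda>(x, X). F x X)"
    and H_cont: "continuous_on UNIV H"
    and f_cont: "continuous_on \<Omega> f"
    and F_mono: "\<And>x X Y. x \<in> \<Omega> \<Longrightarrow> X \<in> sym_matrices \<Longrightarrow> Y \<in> sym_matrices
      \<Longrightarrow> loewner_le X Y \<Longrightarrow> F x X \<le> F x Y"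
begin

abbreviation residual :: "(real^'n \<Rightarrow> real) \<Rightarrow> real^'n \<Rightarrow> real" where
  "residual \<psi> x \<equiv> F x (hessian \<psi> x) + H (gradient \<psi> x) - f x"

text \<open>The quadratic adds \<gamma> I to the Hessian and \<gamma> (x - x0) to the gradient, so
  the residual is jointly continuous in \<gamma> and x and stays in the open set T; the constant c
  does not change derivatives. T is the negative half-line for subsolutions and the positive one for
  supersolutions.\<close>

lemma perturbed_residual:
  assumes \<psi>: "C2_on \<Omega> \<psi>" and "x0 \<in> \<Omega>" "open T" "residual \<psi> x0 \<in> T"
  obtains \<delta> where "\<delta> > 0" "cball x0 \<delta> \<subseteq> \<Omega>"
    "\<And>\<gamma> c x. \<bar>\<gamma>\<bar> \<le> \<delta> \<Longrightarrow> x \<in> cball x0 \<delta>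
      \<Longrightarrow> residual (\<lambda>x. \<psi> x + (\<gamma> / 2 * ((x - x0) \<bullet> (x - x0)) + c)) x \<in> T"
proof -
  note q = C2_on_quadratic[OF open_domain] gradient_quadratic[OF open_domain]
    hessian_quadratic[OF open_domain]
  define G where "G = (\<lambda>(\<gamma>, x). F x (hessian \<psi> x + \<gamma> *\<^sub>R mat 1)
    + H (gradient \<psi> x + \<gamma> *\<^sub>R (x - x0)) - f x)"
  have G: "residual (\<lambda>x. \<psi> x + (\<gamma> / 2 * ((x - x0) \<bullet> (x - x0)) + c)) x = G (\<gamma>, x)"
    if "x \<in> \<Omega>" for \<gamma> c x
    using gradient_add[OF open_domain \<psi> q(1) that] hessian_add[OF open_domain \<psi> q(1) that] q that
    by (simp add: G_def)
  have snd: "continuous_on (UNIV \<times> \<Omega>) (\<lambda>z. g (snd z))" if "continuous_on \<Omega> g"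
    for g :: "real^'n \<Rightarrow> 'b::topological_space"
    by (rule continuous_on_compose2[OF that]) (auto intro!: continuous_intros)
  have "continuous_on \<Omega> (hessian \<psi>)" "continuous_on \<Omega> (gradient \<psi>)"
    using \<psi> by (auto simp: C2_on_def differentiable_imp_continuous_on)
  note cont = this[THEN snd] f_cont[THEN snd]
  have "continuous_on (UNIV \<times> \<Omega>) (\<lambda>z. F (snd z) (hessian \<psi> (snd z) + fst z *\<^sub>R mat 1))"
  proof -
    \<comment> \<open>F is continuous on symmetric matrices only; this matrix is symmetric as the
      Hessian of the perturbed function.\<close>
    have "hessian \<psi> x + \<gamma> *\<^sub>R mat 1 \<in> sym_matrices" if "x \<in> \<Omega>" for x \<gamma>
      using hessian_sym[OF open_domain C2_on_add[OF open_domain \<psi> q(1)] that]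
        hessian_add[OF open_domain \<psi> q(1) that] q(3)[OF that] by metis
    then have "continuous_on (UNIV \<times> \<Omega>) (\<lambda>z. (\<lambda>(x, X). F x X)
        (snd z, hessian \<psi> (snd z) + fst z *\<^sub>R mat 1))"
      by (intro continuous_on_compose2[OF F_cont]) (auto intro!: continuous_intros cont)
    then show ?thesis by simp
  qed
  moreover have "continuous_on (UNIV \<times> \<Omega>) (\<lambda>z. H (gradient \<psi> (snd z) + fst z *\<^sub>R (snd z - x0)))"
    by (intro continuous_on_compose2[OF H_cont]) (auto intro!: continuous_intros cont)
  ultimately have "continuous_on (UNIV \<times> \<Omega>) G"
    unfolding G_def case_prod_beta by (intro continuous_intros cont)
  then have "open ((UNIV \<times> \<Omega>) \<inter> G -` T)"
    using open_domain assms(3) by (intro continuous_open_preimage open_Times) auto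
  moreover have "(0, x0) \<in> (UNIV \<times> \<Omega>) \<inter> G -` T"
    using assms(2,4) by (simp add: G_def)
  ultimately obtain A B where AB: "open A" "open B" "0 \<in> A" "x0 \<in> B"
    "A \<times> B \<subseteq> (UNIV \<times> \<Omega>) \<inter> G -` T"
    by (elim open_prod_elim) auto
  obtain d e where "d > 0" "cball 0 d \<subseteq> A" "e > 0" "cball x0 e \<subseteq> B"
    using AB by (meson open_contains_cball)
  note de = this
  show thesis
  proof (rule that[of "min d e"])
    show sub: "cball x0 (min d e) \<subseteq> \<Omega>" using de(4) AB(3,5) by (auto simp: subset_iff)
    fix \<gamma> c x assume *: "\<bar>\<gamma>\<bar> \<le> min d e" "x \<in> cball x0 (min d e)"
    then have "(\<gamma>, x) \<in> A \<times> B" using de(2,4) by (auto simp: subset_iff)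
    then have "G (\<gamma>, x) \<in> T" using AB(5) by auto
    then show "residual (\<lambda>x. \<psi> x + (\<gamma> / 2 * ((x - x0) \<bullet> (x - x0)) + c)) x \<in> T"
      using G * sub by (simp add: subset_iff)
  qed (use de in simp)
qed

text \<open>Adding \<open>\<delta> |x - x0|\<^sup>2 / 2\<close> to the test function makes the maximum strict, so that a \<open>w \<in> W\<close> close to
  \<open>U\<close> near \<open>x0\<close> has an interior maximum nearby.\<close>

lemma subsolution_of_approximation:
  assumes U: "usc_on (closure \<Omega>) U" "\<And>x. x \<in> frontier \<Omega> \<Longrightarrow> U x \<le> 0"
    and W: "\<And>w. w \<in> W \<Longrightarrow> viscosity_subsolution \<Omega> F H f w"
      "\<And>w x. w \<in> W \<Longrightarrow> x \<in> closure \<Omega> \<Longrightarrow> w x \<le> U x"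
    and approx: "\<And>x e r. x \<in> \<Omega> \<Longrightarrow> e > 0 \<Longrightarrow> r > 0
      \<Longrightarrow> \<exists>w\<in>W. \<exists>y\<in>closure \<Omega>. dist x y < r \<and> U x - e < w y"
  shows "viscosity_subsolution \<Omega> F H f U"
  unfolding viscosity_subsolution_def
proof (intro conjI ballI allI impI)
  fix x0 \<psi> assume "x0 \<in> \<Omega>" and "C2_on \<Omega> \<psi> \<and> local_max_at \<Omega> (\<lambda>x. U x - \<psi> x) x0"
  then have \<psi>: "C2_on \<Omega> \<psi>" and max: "local_max_at \<Omega> (\<lambda>x. U x - \<psi> x) x0" by auto
  show "f x0 \<le> F x0 (hessian \<psi> x0) + H (gradient \<psi> x0)"
  proof (rule ccontr)
    assume "\<not> ?thesis"
    then have "residual \<psi> x0 \<in> {..<0}" by simp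
    then obtain \<delta> where \<delta>: "\<delta> > 0" "cball x0 \<delta> \<subseteq> \<Omega>"
      and res: "\<And>\<gamma> c x. \<bar>\<gamma>\<bar> \<le> \<delta> \<Longrightarrow> x \<in> cball x0 \<delta>
        \<Longrightarrow> residual (\<lambda>x. \<psi> x + (\<gamma> / 2 * ((x - x0) \<bullet> (x - x0)) + c)) x \<in> {..<0}"
      by (rule perturbed_residual[OF \<psi> \<open>x0 \<in> \<Omega>\<close> open_lessThan]) blast
    obtain \<rho> where \<rho>: "\<rho> > 0" "\<And>y. y \<in> \<Omega> \<Longrightarrow> dist x0 y < \<rho> \<Longrightarrow> U y - \<psi> y \<le> U x0 - \<psi> x0"
      using max by (rule local_max_atE) blast
    define r where "r = min \<delta> (\<rho> / 2)"
    define \<phi> where "\<phi> x = \<psi> x + (\<delta> / 2 * ((x - x0) \<bullet> (x - x0)) + 0)" for x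
    \<comment> \<open>\<eta> is what the added quadratic costs on the sphere of radius r. The point
      y below loses less than \<eta>/2 in w against U x0 and less than \<eta>/2 in \<phi>, so w -
      \<phi> is larger at y than anywhere on the sphere, and its maximum over the ball lies
      inside.\<close>
    define \<eta> where "\<eta> = \<delta> / 2 * r\<^sup>2"
    have r: "r > 0" "cball x0 r \<subseteq> \<Omega>" "r \<le> \<delta>" "r < \<rho>"
      using \<delta> \<rho>(1) by (auto simp: r_def subset_iff)
    have "\<eta> > 0" using \<delta>(1) r(1) by (simp add: \<eta>_def)
    have C2: "C2_on \<Omega> \<phi>"
      unfolding \<phi>_def[abs_def] by (intro C2_on_add open_domain \<psi> C2_on_quadratic)
    have cont: "continuous_on \<Omega> \<phi>"
      using C2 by (simp add: C2_on_def differentiable_imp_continuous_on)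
    then obtain s where s: "s > 0" "\<And>y. y \<in> \<Omega> \<Longrightarrow> dist y x0 < s \<Longrightarrow> dist (\<phi> y) (\<phi> x0) < \<eta> / 2"
      using \<open>x0 \<in> \<Omega>\<close> \<open>\<eta> > 0\<close> unfolding continuous_on_iff by (meson half_gt_zero)
    obtain w y where w: "w \<in> W" and y: "dist x0 y < min s r" "U x0 - \<eta> / 2 < w y"
      using approx[OF \<open>x0 \<in> \<Omega>\<close>, of "\<eta> / 2" "min s r"] \<open>\<eta> > 0\<close> s(1) r(1) by auto
    have "y \<in> \<Omega>" using y(1) r(2) by (auto simp: subset_iff)
    have usc: "usc_on (cball x0 r) (\<lambda>x. w x + - \<phi> x)"
    proof (rule usc_on_add)
      show "usc_on (cball x0 r) w"
        using W(1)[OF w] usc_on_subset[OF _ order_trans[OF r(2) closure_subset]]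
        by (simp add: viscosity_subsolution_def)
      show "usc_on (cball x0 r) (\<lambda>x. - \<phi> x)"
        using continuous_on_subset[OF cont r(2)]
        by (intro continuous_on_imp_usc_on continuous_on_minus)
    qed
    have "cball x0 r \<noteq> {}" using r(1) by simp
    from usc_on_attains_max[OF compact_cball this usc] obtain z where z: "z \<in> cball x0 r"
      "\<And>x. x \<in> cball x0 r \<Longrightarrow> w x + - \<phi> x \<le> w z + - \<phi> z"
      by blast
    have "z \<in> \<Omega>" using z(1) r(2) by blast
    have "w y - \<phi> y \<le> w z - \<phi> z" using z(2)[of y] y(1) by simp
    moreover have "\<phi> y < \<phi> x0 + \<eta> / 2"
      using s(2)[OF \<open>y \<in> \<Omega>\<close>] y(1) unfolding dist_real_def abs_less_iff
      by (simp add: dist_commute)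
    moreover have "\<phi> x0 = \<psi> x0" by (simp add: \<phi>_def)
    moreover have "w z \<le> U z" using W(2)[OF w] \<open>z \<in> \<Omega>\<close> closure_subset by blast
    moreover have "U z - \<psi> z \<le> U x0 - \<psi> x0" using \<rho>(2)[OF \<open>z \<in> \<Omega>\<close>] z(1) r(4) by simp
    moreover have "\<phi> z = \<psi> z + \<delta> / 2 * (dist x0 z)\<^sup>2"
      by (simp add: \<phi>_def dist_norm norm_minus_commute[of x0] power2_norm_eq_inner)
    ultimately have "\<delta> / 2 * (dist x0 z)\<^sup>2 < \<delta> / 2 * r\<^sup>2"
      using y(2) by (simp add: \<eta>_def)
    then have "(dist x0 z)\<^sup>2 < r\<^sup>2" using \<delta>(1) by simp
    then have "z \<in> ball x0 r" using r(1) by (simp add: power2_less_imp_less)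
    then have "local_max_at \<Omega> (\<lambda>x. w x - \<phi> x) z"
      using z(2) by (intro local_max_atI[of "ball x0 r"]) auto
    then have "residual \<phi> z \<ge> 0"
      using W(1)[OF w] C2 \<open>z \<in> \<Omega>\<close> unfolding viscosity_subsolution_def by fastforce
    moreover have "residual \<phi> z < 0"
      using res[of \<delta> z 0] \<delta>(1) z(1) r(3) by (simp add: \<phi>_def[abs_def])
    ultimately show False by simp
  qed
qed (use U in auto)

text \<open>If \<open>L\<close> failed the test at \<open>x0\<close>, the test function, bent down away from \<open>x0\<close> and lifted by \<open>\<kappa>\<close>,
  could be glued to \<open>U\<close> to give a larger subsolution.\<close>

lemma supersolution_of_maximal_subsolution:
  assumes U: "viscosity_subsolution \<Omega> F H f U"
    and maximal: "\<And>w x. viscosity_subsolution \<Omega> F H f w \<Longrightarrow> x \<in> closure \<Omega> \<Longrightarrow> w x \<le> U x"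
    and L: "lsc_on (closure \<Omega>) L" "\<And>x. x \<in> frontier \<Omega> \<Longrightarrow> 0 \<le> L x"
      "\<And>x. x \<in> closure \<Omega> \<Longrightarrow> L x \<le> U x"
    and approx: "\<And>x e r. x \<in> \<Omega> \<Longrightarrow> e > 0 \<Longrightarrow> r > 0
      \<Longrightarrow> \<exists>y\<in>closure \<Omega>. dist x y < r \<and> U y < L x + e"
  shows "viscosity_supersolution \<Omega> F H f L"
  unfolding viscosity_supersolution_def
proof (intro conjI ballI allI impI)
  fix x0 \<psi> assume "x0 \<in> \<Omega>" and "C2_on \<Omega> \<psi> \<and> local_min_at \<Omega> (\<lambda>x. L x - \<psi> x) x0"
  then have \<psi>: "C2_on \<Omega> \<psi>" and min: "local_max_at \<Omega> (\<lambda>x. - (L x - \<psi> x)) x0"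
    by (auto simp: local_min_at_iff_local_max_at_minus)
  show "F x0 (hessian \<psi> x0) + H (gradient \<psi> x0) \<le> f x0"
  proof (rule ccontr)
    assume "\<not> ?thesis"
    then have "residual \<psi> x0 \<in> {0<..}" by simp
    then obtain \<delta> where \<delta>: "\<delta> > 0" "cball x0 \<delta> \<subseteq> \<Omega>"
      and res: "\<And>\<gamma> c x. \<bar>\<gamma>\<bar> \<le> \<delta> \<Longrightarrow> x \<in> cball x0 \<delta>
        \<Longrightarrow> residual (\<lambda>x. \<psi> x + (\<gamma> / 2 * ((x - x0) \<bullet> (x - x0)) + c)) x \<in> {0<..}"
      by (rule perturbed_residual[OF \<psi> \<open>x0 \<in> \<Omega>\<close> open_greaterThan]) blast
    obtain \<rho> where \<rho>: "\<rho> > 0"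
      "\<And>y. y \<in> \<Omega> \<Longrightarrow> dist x0 y < \<rho> \<Longrightarrow> - (L y - \<psi> y) \<le> - (L x0 - \<psi> x0)"
      using min by (rule local_max_atE) blast
    define r where "r = min \<delta> (\<rho> / 2)"
    have r: "r > 0" "cball x0 r \<subseteq> \<Omega>" "r \<le> \<delta>" "r < \<rho>"
      using \<delta> \<rho>(1) by (auto simp: r_def subset_iff)
    \<comment> \<open>\<kappa> is the drop of the quadratic at distance r/2. After lifting by
      \<kappa>, \<phi> is still at most L, hence at most U, from there outwards, so w equals U on a
      whole collar inside the sphere and the gluing creates no new values at its edge.\<close>
    define \<kappa> where "\<kappa> = \<delta> / 2 * (r / 2)\<^sup>2"
    define c where "c = L x0 - \<psi> x0 + \<kappa>"
    define \<phi> where "\<phi> x = \<psi> x + (- \<delta> / 2 * ((x - x0) \<bullet> (x - x0)) + c)" for x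
    define w where "w x = (if dist x0 x < r then max (U x) (\<phi> x) else U x)" for x
    have "\<kappa> > 0" using \<delta>(1) r(1) by (simp add: \<kappa>_def)
    have \<phi>x0: "\<phi> x0 = L x0 + \<kappa>" by (simp add: \<phi>_def c_def)
    have C2: "C2_on \<Omega> \<phi>"
      unfolding \<phi>_def[abs_def] by (intro C2_on_add open_domain \<psi> C2_on_quadratic)
    have cont: "continuous_on \<Omega> \<phi>"
      using C2 by (simp add: C2_on_def differentiable_imp_continuous_on)
    have U_le_w: "U x \<le> w x" for x by (simp add: w_def)
    have \<phi>_le_U: "\<phi> x \<le> U x" if "r / 2 \<le> dist x0 x" "dist x0 x < r" for x
    proof -
      have "x \<in> \<Omega>" using r(2) that(2) by (auto simp: subset_iff)
      have "\<phi> x = \<psi> x - \<delta> / 2 * (dist x0 x)\<^sup>2 + c"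
        by (simp add: \<phi>_def dist_norm norm_minus_commute[of x0] power2_norm_eq_inner)
      also have "\<dots> \<le> \<psi> x - \<kappa> + c"
        unfolding \<kappa>_def using \<delta>(1) r(1) that(1) by (simp add: power_mono)
      also have "\<dots> \<le> L x" using \<rho>(2)[OF \<open>x \<in> \<Omega>\<close>] that(2) r(4) by (simp add: c_def)
      also have "\<dots> \<le> U x" using L(3) \<open>x \<in> \<Omega>\<close> closure_subset by blast
      finally show ?thesis .
    qed
    then have w_eq_U: "w x = U x" if "r / 2 \<le> dist x0 x" for x
      using \<phi>_le_U[OF that] by (simp add: w_def)
    have "viscosity_subsolution \<Omega> F H f w"
      unfolding viscosity_subsolution_def
    proof (intro conjI ballI allI impI)
      have uscU: "usc_on (closure \<Omega>) U"
        using U by (simp add: viscosity_subsolution_def)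
      show "usc_on (closure \<Omega>) w"
        unfolding usc_on_iff_nhds
      proof (intro ballI allI impI)
        fix x a assume x: "x \<in> closure \<Omega>" "w x < a"
        then have "U x < a" using U_le_w[of x] by simp
        then obtain r1 where r1: "r1 > 0" "\<And>y. y \<in> closure \<Omega> \<Longrightarrow> dist x y < r1 \<Longrightarrow> U y < a"
          using uscU x(1) unfolding usc_on_iff_nhds by blast
        show "\<exists>r>0. \<forall>y\<in>closure \<Omega>. dist x y < r \<longrightarrow> w y < a"
        proof (cases "dist x0 x < r")
          case True
          then have "x \<in> \<Omega>" "\<phi> x < a" using x(2) r(2) by (auto simp: w_def subset_iff)
          then obtain r2 where r2: "r2 > 0" "\<And>y. y \<in> \<Omega> \<Longrightarrow> dist x y < r2 \<Longrightarrow> \<phi> y < a"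
            using continuous_on_imp_usc_on[OF cont] unfolding usc_on_iff_nhds by blast
          have "w y < a" if "y \<in> closure \<Omega>" "dist x y < min r1 r2" for y
            using r1(2)[of y] r2(2)[of y] that r(2) by (auto simp: w_def subset_iff)
          then show ?thesis using r1(1) r2(1) by (intro exI[of _ "min r1 r2"]) auto
        next
          case False
          have "w y < a" if "y \<in> closure \<Omega>" "dist x y < min r1 (r / 2)" for y
          proof -
            have "r / 2 \<le> dist x0 y"
              using False that(2) dist_triangle[of x0 x y] by (simp add: dist_commute)
            then show ?thesis using w_eq_U r1(2) that by simp
          qed
          then show ?thesis using r1(1) r(1) by (intro exI[of _ "min r1 (r / 2)"]) auto
        qed
      qed
      show "w x \<le> 0" if "x \<in> frontier \<Omega>" for x
      proof -
        have "x \<notin> \<Omega>" using that open_domain by (simp add: frontier_def interior_open)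
        then have "w x = U x" using r(2) by (auto simp: w_def subset_iff)
        then show ?thesis using U that by (simp add: viscosity_subsolution_def)
      qed
      fix x1 \<theta> assume "x1 \<in> \<Omega>" and "C2_on \<Omega> \<theta> \<and> local_max_at \<Omega> (\<lambda>x. w x - \<theta> x) x1"
      then have \<theta>: "C2_on \<Omega> \<theta>" and max: "local_max_at \<Omega> (\<lambda>x. w x - \<theta> x) x1" by auto
      show "f x1 \<le> F x1 (hessian \<theta> x1) + H (gradient \<theta> x1)"
      proof (cases "w x1 = U x1")
        case True
        then have "local_max_at \<Omega> (\<lambda>x. U x - \<theta> x) x1"
          using max U_le_w by (intro local_max_at_mono[OF max]) auto
        then show ?thesis
          using U \<theta> \<open>x1 \<in> \<Omega>\<close> by (simp add: viscosity_subsolution_def)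
      next
        case False
        then have x1: "x1 \<in> ball x0 r" "w x1 = \<phi> x1"
          by (auto simp: w_def max_def split: if_splits)
        obtain d where d: "d > 0"
          "\<And>y. y \<in> \<Omega> \<Longrightarrow> dist x1 y < d \<Longrightarrow> w y - \<theta> y \<le> w x1 - \<theta> x1"
          using max by (rule local_max_atE) blast
        \<comment> \<open>In the ball \<phi> lies below w, with equality at x1, so \<theta> touches
          the smooth \<phi> there as well.\<close>
        have "local_max_at \<Omega> (\<lambda>x. \<phi> x - \<theta> x) x1"
        proof (rule local_max_atI[of "ball x0 r \<inter> ball x1 d"])
          show "\<phi> y - \<theta> y \<le> \<phi> x1 - \<theta> x1" if "y \<in> ball x0 r \<inter> ball x1 d" "y \<in> \<Omega>" for y
            using d(2)[of y] that x1(2) by (simp add: w_def max_def split: if_splits)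
        qed (use x1 d(1) in auto)
        note test = second_derivative_test_diff[OF open_domain C2 \<theta> \<open>x1 \<in> \<Omega>\<close> this]
        have "F x1 (hessian \<phi> x1) \<le> F x1 (hessian \<theta> x1)"
          using test(2) \<open>x1 \<in> \<Omega>\<close> C2 \<theta> by (intro F_mono hessian_sym[OF open_domain])
        moreover have "residual \<phi> x1 > 0"
          using res[of "- \<delta>" x1 c] \<delta>(1) x1(1) r(3) by (simp add: \<phi>_def[abs_def])
        ultimately show ?thesis using test(1) by simp
      qed
    qed
    then have w_le_U: "w x \<le> U x" if "x \<in> closure \<Omega>" for x using maximal that by blast
    \<comment> \<open>By definition of c, \<phi> exceeds L by \<kappa> at x0, hence exceeds L x0 +
      \<kappa>/2 nearby, where U also takes values below L x0 + \<kappa>/2. At such a point w is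
      larger than the maximal subsolution U.\<close>
    obtain s where s: "s > 0" "\<And>y. y \<in> \<Omega> \<Longrightarrow> dist y x0 < s \<Longrightarrow> dist (\<phi> y) (\<phi> x0) < \<kappa> / 2"
      using cont \<open>x0 \<in> \<Omega>\<close> \<open>\<kappa> > 0\<close> unfolding continuous_on_iff by (meson half_gt_zero)
    obtain y where y: "y \<in> closure \<Omega>" "dist x0 y < min s r" "U y < L x0 + \<kappa> / 2"
      using approx[OF \<open>x0 \<in> \<Omega>\<close>, of "\<kappa> / 2" "min s r"] \<open>\<kappa> > 0\<close> s(1) r(1) by auto
    have "y \<in> \<Omega>" using y(2) r(2) by (auto simp: subset_iff)
    then have "\<phi> x0 - \<kappa> / 2 < \<phi> y"
      using s(2)[of y] y(2) unfolding dist_real_def abs_less_iff by (simp add: dist_commute)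
    moreover have "\<phi> y \<le> w y" using y(2) by (simp add: w_def)
    ultimately show False using w_le_U[OF y(1)] y(3) \<phi>x0 by simp
  qed
qed (use L in auto)

text \<open>Both boundary conditions come from squeezing: V bounds the envelope U from above, so U
  is at most 0 on the boundary, and the zero subsolution keeps L nonnegative. V is continuous so
  that the bound survives passing from the supremum u to its upper envelope. Equality of U and L is
  left to comparison.\<close>

lemma perron:
  assumes zero: "viscosity_subsolution \<Omega> F H f (\<lambda>x. 0)"
    and "bounded \<Omega>"
    and V: "continuous_on (closure \<Omega>) V" "\<And>x. x \<in> frontier \<Omega> \<Longrightarrow> V x \<le> 0"
    and le_V: "\<And>w x. viscosity_subsolution \<Omega> F H f w \<Longrightarrow> x \<in> closure \<Omega> \<Longrightarrow> w x \<le> V x"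
  obtains U L where "viscosity_subsolution \<Omega> F H f U" "viscosity_supersolution \<Omega> F H f L"
    "\<And>x. x \<in> closure \<Omega> \<Longrightarrow> L x \<le> U x"
proof -
  define W where "W = {w. viscosity_subsolution \<Omega> F H f w}"
  define u where "u x = (SUP w\<in>W. w x)" for x
  have "compact (closure \<Omega>)" using \<open>bounded \<Omega>\<close> by (simp add: compact_closure)
  then have "bounded (V ` closure \<Omega>)"
    using V(1) compact_continuous_image compact_imp_bounded by blast
  then obtain M where "\<forall>x\<in>closure \<Omega>. \<bar>V x\<bar> \<le> M"
    unfolding bounded_iff by auto
  then have M: "V x \<le> M" if "x \<in> closure \<Omega>" for x
    using that by (auto dest: abs_le_D1)
  have "W \<noteq> {}" using zero by (auto simp: W_def)
  have bdd: "bdd_above ((\<lambda>w. w x) ` W)" if "x \<in> closure \<Omega>" for x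
    using le_V that by (intro bdd_aboveI2[of _ _ "V x"]) (auto simp: W_def)
  have w_le_u: "w x \<le> u x" if "w \<in> W" "x \<in> closure \<Omega>" for w x
    unfolding u_def using that bdd by (intro cSUP_upper)
  have u_le_V: "u x \<le> V x" if "x \<in> closure \<Omega>" for x
    unfolding u_def using that le_V \<open>W \<noteq> {}\<close> by (intro cSUP_least) (auto simp: W_def)
  have u_bounds: "0 \<le> u x" "u x \<le> M" if "x \<in> closure \<Omega>" for x
    using w_le_u[of "\<lambda>x. 0" x] zero u_le_V[OF that] M[OF that] that by (auto simp: W_def)
  obtain U where U: "usc_on (closure \<Omega>) U" "\<And>x. x \<in> closure \<Omega> \<Longrightarrow> u x \<le> U x"
    and approx_u: "\<And>x e r. x \<in> closure \<Omega> \<Longrightarrow> e > 0 \<Longrightarrow> r > 0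
      \<Longrightarrow> \<exists>y\<in>closure \<Omega>. dist x y < r \<and> U x - e < u y"
    using u_bounds by (rule usc_envelope) blast+
  have U_le_V: "U x \<le> V x" if "x \<in> closure \<Omega>" for x
  proof (rule ccontr)
    define e where "e = (U x - V x) / 2"
    assume "\<not> U x \<le> V x"
    then have "e > 0" by (simp add: e_def)
    then have "V x < V x + e" by simp
    then obtain r where r: "r > 0" "\<And>y. y \<in> closure \<Omega> \<Longrightarrow> dist x y < r \<Longrightarrow> V y < V x + e"
      using continuous_on_imp_usc_on[OF V(1), unfolded usc_on_iff_nhds, rule_format,
          OF \<open>x \<in> closure \<Omega>\<close>] by blast
    obtain y where "y \<in> closure \<Omega>" "dist x y < r" "U x - e < u y"
      using approx_u[OF \<open>x \<in> closure \<Omega>\<close> \<open>e > 0\<close> \<open>r > 0\<close>] by blast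
    then have "U x - e < V x + e" using u_le_V[of y] r(2)[of y] by linarith
    then show False by (simp add: e_def field_simps)
  qed
  have approx_w: "\<exists>w\<in>W. \<exists>y\<in>closure \<Omega>. dist x y < r \<and> U x - e < w y"
    if "x \<in> \<Omega>" "e > 0" "r > 0" for x e r
  proof -
    obtain y where y: "y \<in> closure \<Omega>" "dist x y < r" "U x - e < u y"
      using approx_u[OF subsetD[OF closure_subset \<open>x \<in> \<Omega>\<close>] \<open>e > 0\<close> \<open>r > 0\<close>] by blast
    then have "\<exists>w\<in>W. U x - e < w y"
      using less_cSUP_iff[OF \<open>W \<noteq> {}\<close> bdd] by (simp add: u_def)
    with y show ?thesis by blast
  qed
  have sub: "viscosity_subsolution \<Omega> F H f U"
  proof (rule subsolution_of_approximation[of U W])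
    show "U x \<le> 0" if "x \<in> frontier \<Omega>" for x
      using U_le_V[of x] V(2)[OF that] that by (simp add: frontier_def)
    show "w x \<le> U x" if "w \<in> W" "x \<in> closure \<Omega>" for w x
      using w_le_u[OF that] U(2)[OF that(2)] by simp
  qed (use U(1) approx_w in \<open>auto simp: W_def\<close>)
  have maximal: "w x \<le> U x" if "viscosity_subsolution \<Omega> F H f w" "x \<in> closure \<Omega>" for w x
    using w_le_u[of w x] U(2)[of x] that by (simp add: W_def)
  have U_bounds: "0 \<le> U x" "U x \<le> M" if "x \<in> closure \<Omega>" for x
    using maximal[OF zero that] U_le_V[OF that] M[OF that] by auto
  obtain L where L: "lsc_on (closure \<Omega>) L" "\<And>x. x \<in> closure \<Omega> \<Longrightarrow> L x \<le> U x"
    and approx_U: "\<And>x e r. x \<in> closure \<Omega> \<Longrightarrow> e > 0 \<Longrightarrow> r > 0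
      \<Longrightarrow> \<exists>y\<in>closure \<Omega>. dist x y < r \<and> U y < L x + e"
    using U_bounds by (rule lsc_envelope) blast+
  have "0 \<le> L x" if "x \<in> closure \<Omega>" for x
  proof (rule field_le_epsilon)
    fix e :: real assume "e > 0"
    then obtain y where "y \<in> closure \<Omega>" "U y < L x + e"
      using approx_U[OF \<open>x \<in> closure \<Omega>\<close> \<open>e > 0\<close> zero_less_one] by blast
    then show "0 \<le> L x + e" using U_bounds(1)[of y] by simp
  qed
  then have "viscosity_supersolution \<Omega> F H f L"
    using sub maximal L(1) L(2) approx_U[OF subsetD[OF closure_subset]]
    by (intro supersolution_of_maximal_subsolution[of U L]) (auto simp: frontier_def)
  with sub L(2) show thesis by (intro that)
qed

end

subsection \<open>Barrier and scaling\<close>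

locale uniformly_elliptic_homogeneous =
  fixes \<Omega> :: "(real^'n) set" and F :: "real^'n \<Rightarrow> real^'n^'n \<Rightarrow> real"
    and H f :: "real^'n \<Rightarrow> real" and \<beta> :: real
  assumes open_domain: "open \<Omega>"
    and F_cont: "continuous_on (\<Omega> \<times> sym_matrices) (\<lambda>(x, X). F x X)"
    and H_cont: "continuous_on UNIV H"
    and f_cont: "continuous_on \<Omega> f"
    and \<beta>_pos: "\<beta> > 0"
    and F_elliptic: "\<And>x X Z. x \<in> \<Omega> \<Longrightarrow> X \<in> sym_matrices \<Longrightarrow> Z \<in> sym_matrices \<Longrightarrow> loewner_le Z 0
          \<Longrightarrow> F x (X + Z) - F x X \<le> \<beta> * max_eigenvalue Z"
    and F_homogeneous: "\<And>\<sigma> x X. \<sigma> > 0 \<Longrightarrow> x \<in> \<Omega> \<Longrightarrow> X \<in> sym_matrices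
          \<Longrightarrow> F x (\<sigma> *\<^sub>R X) = \<sigma> * F x X"
    and H_nonneg: "\<And>\<xi>. 0 \<le> H \<xi>"
begin

text \<open>If X \<le> Y, the increment X - Y has largest eigenvalue at most 0, so ellipticity based
  at Y gives monotonicity.\<close>

sublocale degenerate_elliptic \<Omega> F H f
proof (unfold_locales; (intro open_domain F_cont H_cont f_cont)?)
  fix x :: "real^'n" and X Y :: "real^'n^'n"
  assume x: "x \<in> \<Omega>" and XY: "X \<in> sym_matrices" "Y \<in> sym_matrices" "loewner_le X Y"
  have "X - Y \<in> sym_matrices"
    using XY by (simp add: sym_matrices_def transpose_def vec_eq_iff)
  moreover have "loewner_le (X - Y) 0"
    using XY(3) by (simp add: loewner_le_def matrix_vector_mult_diff_rdistrib inner_diff_right)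
  moreover from this have "loewner_le (X - Y) (0 *\<^sub>R mat 1)"
    by simp
  ultimately have "F x (Y + (X - Y)) - F x Y \<le> \<beta> * max_eigenvalue (X - Y)"
    and "max_eigenvalue (X - Y) \<le> 0"
    using F_elliptic[OF x XY(2)] max_eigenvalue_le by blast+
  moreover from this have "\<beta> * max_eigenvalue (X - Y) \<le> 0"
    using \<beta>_pos by (simp add: mult_nonneg_nonpos)
  ultimately show "F x X \<le> F x Y" by simp
qed

lemma F_zero: "x \<in> \<Omega> \<Longrightarrow> F x 0 = 0"
  using F_homogeneous[of 2 x 0] zero_sym_matrices by simp

text \<open>Ellipticity based at the zero matrix, where homogeneity makes F vanish. This linear gain
  in A is what absorbs H and f in the barrier.\<close>

lemma F_le_if_loewner_le_neg:
  assumes "x \<in> \<Omega>" "X \<in> sym_matrices" "loewner_le X ((- A) *\<^sub>R mat 1)" "0 \<le> A"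
  shows "F x X \<le> - \<beta> * A"
proof -
  have "\<xi> \<bullet> (X *v \<xi>) \<le> 0" for \<xi>
  proof -
    have "\<xi> \<bullet> (X *v \<xi>) \<le> - A * (\<xi> \<bullet> \<xi>)"
      using assms(3) by (simp add: loewner_le_def scaleR_matrix_vector_assoc[symmetric] del: scaleR_minus_left)
    also have "\<dots> \<le> 0" using assms(4) by (simp add: mult_nonpos_nonneg)
    finally show ?thesis .
  qed
  then have "loewner_le X 0" by (simp add: loewner_le_def)
  then have "F x (0 + X) - F x 0 \<le> \<beta> * max_eigenvalue X"
    using assms(1,2) by (intro F_elliptic zero_sym_matrices)
  also have "\<dots> \<le> \<beta> * - A"
    using max_eigenvalue_le[OF assms(2,3)] \<beta>_pos by (intro mult_left_mono) auto
  finally show ?thesis using F_zero[OF assms(1)] by simp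
qed

lemma zero_subsolution:
  assumes "\<And>x. x \<in> \<Omega> \<Longrightarrow> f x \<le> 0"
  shows "viscosity_subsolution \<Omega> F H f (\<lambda>x. 0)"
  unfolding viscosity_subsolution_def
proof (intro conjI ballI allI impI)
  show "usc_on (closure \<Omega>) (\<lambda>x. 0)" by (simp add: usc_on_def)
  fix x0 \<psi> assume x0: "x0 \<in> \<Omega>" and "C2_on \<Omega> \<psi> \<and> local_max_at \<Omega> (\<lambda>x. 0 - \<psi> x) x0"
  then have \<psi>: "C2_on \<Omega> \<psi>" and max: "local_max_at \<Omega> (\<lambda>x. 0 - \<psi> x) x0" by auto
  have zero: "C2_on \<Omega> (\<lambda>x. 0)" "hessian (\<lambda>x. 0) x0 = 0"
    using C2_on_quadratic[OF open_domain, of 0 0 0]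
      hessian_quadratic[OF open_domain x0, of 0 0 0] by simp_all
  have "F x0 (hessian (\<lambda>x. 0) x0) \<le> F x0 (hessian \<psi> x0)"
    using second_derivative_test_diff(2)[OF open_domain zero(1) \<psi> x0 max] zero(1) \<psi> x0
    by (intro F_mono hessian_sym[OF open_domain])
  then have "0 \<le> F x0 (hessian \<psi> x0)" using zero(2) F_zero[OF x0] by simp
  then show "f x0 \<le> F x0 (hessian \<psi> x0) + H (gradient \<psi> x0)"
    using assms[OF x0] H_nonneg[of "gradient \<psi> x0"] by linarith
qed auto

text \<open>The test function at \<open>x\<close> is compared with the paraboloid centred at a farthest point \<open>y\<close>,
  which touches the barrier from above at \<open>x\<close>.\<close>

lemma barrier_supersolution:
  assumes m: "continuous_on UNIV m" "\<And>x. x \<in> frontier \<Omega> \<Longrightarrow> m x = R"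
      "\<And>x. x \<in> \<Omega> \<Longrightarrow> m x \<le> R"
      "\<And>x. \<exists>y. m x = dist x y \<and> (\<forall>z. dist z y \<le> m z)"
    and "A > 0"
    and large: "\<And>x \<xi>. x \<in> \<Omega> \<Longrightarrow> norm \<xi> \<le> A * R \<Longrightarrow> H \<xi> - \<beta> * A \<le> f x"
  shows "viscosity_supersolution \<Omega> F H f (\<lambda>x. A / 2 * (R\<^sup>2 - (m x)\<^sup>2))"
  unfolding viscosity_supersolution_def
proof (intro conjI ballI allI impI)
  show "lsc_on (closure \<Omega>) (\<lambda>x. A / 2 * (R\<^sup>2 - (m x)\<^sup>2))"
    by (intro continuous_on_imp_lsc_on continuous_intros continuous_on_subset[OF m(1)]) auto
  show "0 \<le> A / 2 * (R\<^sup>2 - (m x)\<^sup>2)" if "x \<in> frontier \<Omega>" for x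
    using m(2)[OF that] by simp
  fix x0 \<psi> assume x0: "x0 \<in> \<Omega>"
    and "C2_on \<Omega> \<psi> \<and> local_min_at \<Omega> (\<lambda>x. A / 2 * (R\<^sup>2 - (m x)\<^sup>2) - \<psi> x) x0"
  then have \<psi>: "C2_on \<Omega> \<psi>"
    and max: "local_max_at \<Omega> (\<lambda>x. - (A / 2 * (R\<^sup>2 - (m x)\<^sup>2) - \<psi> x)) x0"
    by (auto simp: local_min_at_iff_local_max_at_minus)
  obtain y where y: "m x0 = dist x0 y" "\<And>z. dist z y \<le> m z" using m(4) by blast
  define q where "q x = - A / 2 * ((x - y) \<bullet> (x - y)) + A / 2 * R\<^sup>2" for x
  have q: "q x = A / 2 * (R\<^sup>2 - (dist x y)\<^sup>2)" for x
    by (simp add: q_def dist_norm power2_norm_eq_inner algebra_simps)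
  have C2q: "C2_on \<Omega> q" "gradient q x0 = (- A) *\<^sub>R (x0 - y)" "hessian q x0 = (- A) *\<^sub>R mat 1"
    unfolding q_def[abs_def] using C2_on_quadratic[OF open_domain]
      gradient_quadratic[OF open_domain x0] hessian_quadratic[OF open_domain x0] by blast+
  have "local_max_at \<Omega> (\<lambda>x. \<psi> x - q x) x0"
  proof (rule local_max_at_mono[OF max])
    show "\<psi> x - q x \<le> - (A / 2 * (R\<^sup>2 - (m x)\<^sup>2) - \<psi> x)" for x
      using power_mono[OF y(2)[of x], of 2] \<open>A > 0\<close> by (simp add: q)
  qed (simp add: q y(1))
  note test = second_derivative_test_diff[OF open_domain \<psi> C2q(1) x0 this, unfolded C2q(2,3)]
  have "F x0 (hessian \<psi> x0) \<le> - \<beta> * A"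
    using test(2) \<open>A > 0\<close> by (intro F_le_if_loewner_le_neg hessian_sym[OF open_domain \<psi>] x0) auto
  moreover have "norm (gradient \<psi> x0) \<le> A * R"
    using test(1) \<open>A > 0\<close> m(3)[OF x0] y(1) by (simp add: dist_norm)
  ultimately show "F x0 (hessian \<psi> x0) + H (gradient \<psi> x0) \<le> f x0"
    using large[OF x0] by force
qed

text \<open>If \<psi> tests \<sigma> v, then \<psi>/\<sigma> tests v. Multiplying the inequality for
  v by \<sigma>, with the scaling of H taken at 1/\<sigma>, leaves \<sigma> f = f + (\<sigma> - 1) f
  on the right, and f \<le> -m makes (\<sigma> - 1) m the margin of strictness.\<close>

lemma scaled_strict_supersolution:
  assumes H_scaling: "\<And>\<epsilon> \<xi>. 0 < \<epsilon> \<Longrightarrow> \<epsilon> < 1 \<Longrightarrow> \<epsilon> * H \<xi> \<le> H (\<epsilon> *\<^sub>R \<xi>)"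
    and f_neg: "m > 0" "\<And>x. x \<in> \<Omega> \<Longrightarrow> f x \<le> - m"
    and v: "viscosity_supersolution \<Omega> F H f v" and "\<sigma> > 1"
  shows "strict_viscosity_supersolution \<Omega> F H f (\<lambda>x. \<sigma> * v x)"
  unfolding strict_viscosity_supersolution_def viscosity_supersolution_def
proof (intro exI conjI ballI allI impI)
  show "0 < (\<sigma> - 1) * m" using \<open>\<sigma> > 1\<close> f_neg(1) by simp
  show "lsc_on (closure \<Omega>) (\<lambda>x. \<sigma> * v x)"
    unfolding lsc_on_def
  proof (intro ballI allI impI)
    fix x a assume "x \<in> closure \<Omega>" "a < \<sigma> * v x"
    then have "a / \<sigma> < v x"
      using \<open>\<sigma> > 1\<close> by (simp add: divide_less_eq mult.commute)
    then have "\<forall>\<^sub>F y in at x within closure \<Omega>. a / \<sigma> < v y"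
      using v \<open>x \<in> closure \<Omega>\<close> by (simp add: viscosity_supersolution_def lsc_on_def)
    then show "\<forall>\<^sub>F y in at x within closure \<Omega>. a < \<sigma> * v y"
      using \<open>\<sigma> > 1\<close> by (simp add: divide_less_eq mult.commute)
  qed
  show "0 \<le> \<sigma> * v x" if "x \<in> frontier \<Omega>" for x
    using v that \<open>\<sigma> > 1\<close> by (simp add: viscosity_supersolution_def)
  fix x0 \<psi> assume x0: "x0 \<in> \<Omega>" and "C2_on \<Omega> \<psi> \<and> local_min_at \<Omega> (\<lambda>x. \<sigma> * v x - \<psi> x) x0"
  then have \<psi>: "C2_on \<Omega> \<psi>" and min: "local_min_at \<Omega> (\<lambda>x. \<sigma> * v x - \<psi> x) x0" by auto
  have "\<sigma> * a - b \<le> \<sigma> * c - d \<longleftrightarrow> a - 1 / \<sigma> * b \<le> c - 1 / \<sigma> * d" for a b c d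
  proof -
    have "\<sigma> * a - b = \<sigma> * (a - 1 / \<sigma> * b)" for a b
      using \<open>\<sigma> > 1\<close> by (simp add: right_diff_distrib)
    then show ?thesis
      using \<open>\<sigma> > 1\<close> by (simp only: mult_le_cancel_left_pos)
  qed
  then have "local_min_at \<Omega> (\<lambda>x. v x - 1 / \<sigma> * \<psi> x) x0"
    using min by (simp only: local_min_at_def)
  then have "F x0 (hessian (\<lambda>x. 1 / \<sigma> * \<psi> x) x0) + H (gradient (\<lambda>x. 1 / \<sigma> * \<psi> x) x0) \<le> f x0"
    using v x0 C2_on_scale[OF open_domain \<psi>] unfolding viscosity_supersolution_def by blast
  then have "F x0 ((1 / \<sigma>) *\<^sub>R hessian \<psi> x0) + H ((1 / \<sigma>) *\<^sub>R gradient \<psi> x0) \<le> f x0"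
    by (simp only: gradient_scale[OF open_domain \<psi> x0] hessian_scale[OF open_domain \<psi> x0])
  moreover have "F x0 ((1 / \<sigma>) *\<^sub>R hessian \<psi> x0) = 1 / \<sigma> * F x0 (hessian \<psi> x0)"
    using \<open>\<sigma> > 1\<close> by (intro F_homogeneous x0 hessian_sym[OF open_domain \<psi> x0]) simp
  moreover have "1 / \<sigma> * H (gradient \<psi> x0) \<le> H ((1 / \<sigma>) *\<^sub>R gradient \<psi> x0)"
    using \<open>\<sigma> > 1\<close> by (intro H_scaling) auto
  ultimately have "1 / \<sigma> * (F x0 (hessian \<psi> x0) + H (gradient \<psi> x0)) \<le> f x0"
    by (simp add: algebra_simps)
  then have "F x0 (hessian \<psi> x0) + H (gradient \<psi> x0) \<le> \<sigma> * f x0"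
    using \<open>\<sigma> > 1\<close> by (simp add: field_simps)
  moreover have "(\<sigma> - 1) * f x0 \<le> (\<sigma> - 1) * - m"
    using f_neg(2)[OF x0] \<open>\<sigma> > 1\<close> by (intro mult_left_mono) auto
  ultimately show "F x0 (hessian \<psi> x0) + H (gradient \<psi> x0) \<le> f x0 - (\<sigma> - 1) * m"
    by (simp add: algebra_simps)
qed

end

section \<open>Size of the barrier and the farthest-distance function\<close>

lemma sublinear_dominated:
  fixes \<beta> b p K R :: real
  assumes "0 < \<beta>" "0 < b" "0 < p" "p < 1" "0 < R"
  obtains A where "A > 0" "b * (A * R) powr p + K \<le> \<beta> * A"
proof -
  have "filterlim (\<lambda>A. \<beta> * A - b * (A * R) powr p) at_top at_top"
    using assms by real_asymp
  then have "\<forall>\<^sub>F A in at_top. K \<le> \<beta> * A - b * (A * R) powr p"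
    by (simp add: filterlim_at_top)
  moreover have "\<forall>\<^sub>F A in at_top. A > (0::real)" by (rule eventually_gt_at_top)
  ultimately have "\<forall>\<^sub>F A in at_top. A > 0 \<and> b * (A * R) powr p + K \<le> \<beta> * A"
    by eventually_elim auto
  then show thesis using that eventually_happens'[OF trivial_limit_at_top_linorder] by blast
qed

text \<open>Each point of the closure of the domain lies within R of all centres, and a boundary
  point, being outside the open domain, misses some ball and so has a centre at distance at least R.
  As a supremum of distances, m is 1-Lipschitz.\<close>

lemma farthest_distance:
  fixes \<Omega> :: "(real^'n) set"
  assumes "open \<Omega>" "\<Omega> \<noteq> {}" "bounded \<Omega>" "uniformly_convex \<Omega>"
  obtains R m where "R > 0" "continuous_on UNIV m"
    "\<And>x. x \<in> closure \<Omega> \<Longrightarrow> m x \<le> R" "\<And>x. x \<in> frontier \<Omega> \<Longrightarrow> m x = R"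
    "\<And>x. \<exists>y. m x = dist x y \<and> (\<forall>z. dist z y \<le> m z)"
proof -
  obtain R Y where "R > 0" and \<Omega>: "\<Omega> = (\<Inter>y\<in>Y. ball y R)"
    using assms(4) unfolding uniformly_convex_def by blast
  have "Y \<noteq> {}" using assms(3) not_bounded_UNIV \<Omega> by auto
  \<comment> \<open>The centres need not form a closed set; their closure is compact and makes the
    supremum in \<open>m\<close> attained.\<close>
  define K where "K = closure Y"
  define m where "m x = (SUP y\<in>K. dist x y)" for x
  have K_sub: "K \<subseteq> cball x R" if "x \<in> closure \<Omega>" for x
  proof -
    have "x \<in> cball y R" if "y \<in> Y" for y
    proof -
      have "closure \<Omega> \<subseteq> cball y R"
        using that \<Omega> ball_subset_cball by (intro closure_minimal) auto
      with \<open>x \<in> closure \<Omega>\<close> show ?thesis by blast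
    qed
    then have "Y \<subseteq> cball x R" by (auto simp: dist_commute)
    then show ?thesis unfolding K_def by (intro closure_minimal) auto
  qed
  obtain x1 where "x1 \<in> \<Omega>" using assms(2) by blast
  have "K \<subseteq> cball x1 R" using K_sub subsetD[OF closure_subset \<open>x1 \<in> \<Omega>\<close>] .
  then have "compact K"
    using bounded_subset[OF bounded_cball] by (simp add: K_def compact_eq_bounded_closed)
  have "K \<noteq> {}" using \<open>Y \<noteq> {}\<close> by (simp add: K_def)
  have bdd: "bdd_above (dist x ` K)" for x
    using \<open>compact K\<close> by (intro bounded_imp_bdd_above compact_imp_bounded compact_continuous_image continuous_intros)
  have le_m: "dist x y \<le> m x" if "y \<in> K" for x y
    unfolding m_def using that bdd by (intro cSUP_upper)
  have m_le: "m x \<le> a" if "\<And>y. y \<in> K \<Longrightarrow> dist x y \<le> a" for x a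
    unfolding m_def using that \<open>K \<noteq> {}\<close> by (intro cSUP_least)
  have "m x \<le> m z + dist x z" for x z
  proof (rule m_le)
    show "dist x y \<le> m z + dist x z" if "y \<in> K" for y
      using le_m[OF that, of z] dist_triangle[of x y z] by simp
  qed
  then have "\<bar>m x - m z\<bar> \<le> dist x z" for x z
    by (smt (verit) dist_commute)
  then have "continuous_on UNIV m"
    unfolding continuous_on_iff dist_real_def by (metis dist_commute le_less_trans)
  moreover have m_le_R: "m x \<le> R" if "x \<in> closure \<Omega>" for x
    using K_sub[OF that] by (intro m_le) auto
  moreover have "m x = R" if "x \<in> frontier \<Omega>" for x
  proof (rule antisym)
    show "m x \<le> R" using m_le_R that by (simp add: frontier_def)
    have "x \<notin> \<Omega>" using that assms(1) by (simp add: frontier_def interior_open)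
    then obtain y where "y \<in> Y" "R \<le> dist x y" using \<Omega> by (auto simp: dist_commute not_less)
    moreover have "dist x y \<le> m x"
      using \<open>y \<in> Y\<close> closure_subset[of Y] by (intro le_m) (auto simp: K_def)
    ultimately show "R \<le> m x" by simp
  qed
  moreover have "\<exists>y. m x = dist x y \<and> (\<forall>z. dist z y \<le> m z)" for x
  proof -
    have "continuous_on K (dist x)" by (intro continuous_intros)
    from continuous_attains_sup[OF \<open>compact K\<close> \<open>K \<noteq> {}\<close> this]
    obtain y where y: "y \<in> K" "\<forall>z\<in>K. dist x z \<le> dist x y"
      by blast
    have "m x = dist x y"
      using y le_m[OF y(1), of x] m_le[of x "dist x y"] by (intro antisym) auto
    with y(1) le_m show ?thesis by blast
  qed
  ultimately show thesis using \<open>R > 0\<close> by (intro that)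
qed

theorem theorem6:
  fixes \<Omega> :: "(real^'n) set"
    and F :: "real^'n \<Rightarrow> real^'n^'n \<Rightarrow> real"
    and H :: "real^'n \<Rightarrow> real"
    and f :: "real^'n \<Rightarrow> real"
    and \<beta> b c p :: real
  assumes domain: "open \<Omega>" "connected \<Omega>" "\<Omega> \<noteq> {}" "bounded \<Omega>" "uniformly_convex \<Omega>"
    and F_cont: "continuous_on (\<Omega> \<times> sym_matrices) (\<lambda>(x, X). F x X)"
    and H_cont: "continuous_on UNIV H"
    and \<beta>_pos: "\<beta> > 0"
    and F_elliptic: "\<And>x X Z. x \<in> \<Omega> \<Longrightarrow> X \<in> sym_matrices \<Longrightarrow> Z \<in> sym_matrices \<Longrightarrow> loewner_le Z 0
          \<Longrightarrow> F x (X + Z) - F x X \<le> \<beta> * max_eigenvalue Z"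
    and F_homogeneous: "\<And>\<sigma> x X. \<sigma> > 0 \<Longrightarrow> x \<in> \<Omega> \<Longrightarrow> X \<in> sym_matrices
          \<Longrightarrow> F x (\<sigma> *\<^sub>R X) = \<sigma> * F x X"
    and H_const: "b > 0" "c > 0" "0 < p" "p < 1"
    and H_scaling: "\<And>\<epsilon> \<xi>. 0 < \<epsilon> \<Longrightarrow> \<epsilon> < 1 \<Longrightarrow> \<epsilon> * H \<xi> \<le> H (\<epsilon> *\<^sub>R \<xi>)"
    and H_growth: "\<And>\<xi>. 0 \<le> H \<xi>" "\<And>\<xi>. H \<xi> \<le> b * norm \<xi> powr p + c"
    and f_cont: "continuous_on \<Omega> f"
    and f_bounded: "Linfty_on \<Omega> f"
    and f_neg: "(SUP x\<in>\<Omega>. f x) < 0"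
    and comparison: "\<And>u v. viscosity_subsolution \<Omega> F H f u \<Longrightarrow> strict_viscosity_supersolution \<Omega> F H f v
          \<Longrightarrow> \<forall>x\<in>closure \<Omega>. u x \<le> v x"
  shows "\<exists>u. viscosity_solution \<Omega> F H f u \<and>
           (\<forall>w. viscosity_solution \<Omega> F H f w \<longrightarrow> (\<forall>x\<in>closure \<Omega>. w x = u x))"
proof -
  interpret uniformly_elliptic_homogeneous \<Omega> F H f \<beta>
    using domain(1) F_cont H_cont f_cont \<beta>_pos F_elliptic F_homogeneous H_growth(1)
    by unfold_locales
  obtain C where C: "\<And>x. x \<in> \<Omega> \<Longrightarrow> \<bar>f x\<bar> \<le> C"
    using Linfty_on_continuous_imp_bounded[OF domain(1) f_cont f_bounded] by blast
  define \<mu> where "\<mu> = - (SUP x\<in>\<Omega>. f x)"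
  have "\<mu> > 0" using f_neg by (simp add: \<mu>_def)
  have f_le: "f x \<le> - \<mu>" if "x \<in> \<Omega>" for x
  proof -
    have "bdd_above (f ` \<Omega>)" using C by (intro bdd_aboveI2[of _ _ C]) (auto dest: abs_le_D1)
    then show ?thesis unfolding \<mu>_def using that by (simp add: cSUP_upper)
  qed
  have sub_le_super: "u x \<le> v x" if "viscosity_subsolution \<Omega> F H f u"
    "viscosity_supersolution \<Omega> F H f v" "x \<in> closure \<Omega>" for u v x
  proof -
    have le: "u x \<le> \<sigma> * v x" if "\<sigma> > 1" for \<sigma>
      using comparison[OF \<open>viscosity_subsolution \<Omega> F H f u\<close>
          scaled_strict_supersolution[OF H_scaling \<open>\<mu> > 0\<close> f_le
            \<open>viscosity_supersolution \<Omega> F H f v\<close> that]] \<open>x \<in> closure \<Omega>\<close>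
      by blast
    have "((\<lambda>\<sigma>. \<sigma> * v x) \<longlongrightarrow> 1 * v x) (at_right 1)"
      by (intro tendsto_intros)
    moreover have "\<forall>\<^sub>F \<sigma> in at_right 1. u x \<le> \<sigma> * v x"
      using le by (simp add: eventually_at_right_less eventually_at_filter)
    ultimately show ?thesis
      using tendsto_lowerbound[of "\<lambda>\<sigma>. \<sigma> * v x" "1 * v x" "at_right 1" "u x"] by simp
  qed

  obtain R m where "R > 0" and m: "continuous_on UNIV m"
    "\<And>x. x \<in> closure \<Omega> \<Longrightarrow> m x \<le> R" "\<And>x. x \<in> frontier \<Omega> \<Longrightarrow> m x = R"
    "\<And>x. \<exists>y. m x = dist x y \<and> (\<forall>z. dist z y \<le> m z)"
    by (rule farthest_distance[OF domain(1,3,4,5)]) blast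
  \<comment> \<open>Here c comes from the growth of H and C from f \<ge> -C. For gradients of norm
    at most A R this choice gives H - \<beta> A \<le> -C \<le> f.\<close>
  obtain A where A: "A > 0" "b * (A * R) powr p + (c + C) \<le> \<beta> * A"
    by (rule sublinear_dominated[OF \<beta>_pos H_const(1,3,4) \<open>R > 0\<close>]) blast
  define V where "V x = A / 2 * (R\<^sup>2 - (m x)\<^sup>2)" for x
  have V_super: "viscosity_supersolution \<Omega> F H f V"
    unfolding V_def[abs_def]
  proof (rule barrier_supersolution)
    show "m x \<le> R" if "x \<in> \<Omega>" for x using m(2) subsetD[OF closure_subset that] .
    show "H \<xi> - \<beta> * A \<le> f x" if "x \<in> \<Omega>" "norm \<xi> \<le> A * R" for x \<xi>
    proof -
      have "norm \<xi> powr p \<le> (A * R) powr p"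
        using that(2) H_const(3) by (intro powr_mono2) auto
      then have "H \<xi> \<le> b * (A * R) powr p + c"
        using H_growth(2)[of \<xi>] H_const(1) by (smt (verit) mult_left_mono)
      with A(2) C[OF that(1)] show ?thesis by linarith
    qed
  qed (use m A(1) in auto)
  have zero: "viscosity_subsolution \<Omega> F H f (\<lambda>x. 0)"
    using f_le \<open>\<mu> > 0\<close> by (intro zero_subsolution) force
  have V_cont: "continuous_on (closure \<Omega>) V"
    unfolding V_def by (intro continuous_intros continuous_on_subset[OF m(1)]) auto
  have V_frontier: "V x \<le> 0" if "x \<in> frontier \<Omega>" for x
    using m(3)[OF that] by (simp add: V_def)
  obtain U L where U: "viscosity_subsolution \<Omega> F H f U"
    and L: "viscosity_supersolution \<Omega> F H f L"
    and L_le_U: "\<And>x. x \<in> closure \<Omega> \<Longrightarrow> L x \<le> U x"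
    by (rule perron[OF zero domain(4) V_cont])
      (use V_frontier sub_le_super[OF _ V_super] in blast)+
  have eq: "L x = U x" if "x \<in> closure \<Omega>" for x
    using L_le_U[OF that] sub_le_super[OF U L that] by simp
  have U_super: "viscosity_supersolution \<Omega> F H f U"
    using viscosity_supersolution_cong[of \<Omega> L U] eq L by blast
  then have "continuous_on (closure \<Omega>) U"
    using U by (intro usc_lsc_on_imp_continuous_on)
      (simp_all add: viscosity_subsolution_def viscosity_supersolution_def)
  then have "viscosity_solution \<Omega> F H f U"
    using U U_super by (simp add: viscosity_solution_def)
  moreover have "w x = U x" if "viscosity_solution \<Omega> F H f w" "x \<in> closure \<Omega>" for w x
    using that sub_le_super[of w U x] sub_le_super[of U w x] U U_super
    by (auto simp: viscosity_solution_def)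
  ultimately show ?thesis by blast
qed

end
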